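(* Let $1\le s\le r$ be integers and let $X$ be a compact Hausdorff space with $X\simeq_2\mathbb{C}H_{r,s}$, equipped with a free $\mathbb{Z}_2$-action. Then for any continuous map $f:X\to\mathbb{R}^2$ the coincidence set $A(f,2)$ is non-empty.
   Context: For integers $0\le s\le r$, the complex Milnor manifold is $$\mathbb{C}H_{r,s}=\{([z_0,\dots,z_r],[w_0,\dots,w_s])\in\mathbb{C}P^r\times\mathbb{C}P^s : z_0\overline{w}_0+\cdots+z_s\overline{w}_s=0\}.$$ For spaces $X$ and $Y$, $X\simeq_2 Y$ means that the graded algebras $H^*(X;\mathbb{Z}_2)$ and $H^*(Y;\mathbb{Z}_2)$ are isomorphic (not necessarily via a map between $X$ and $Y$). For a finite group $G$, a $G$-space $X$, and a continuous map $f:X\to Y$, the coincidence set is $$A(f,k)=\{x\in X : \exists \text{ distinct } g_1,\dots,g_k\in G \text{ such that } f(g_1x)=\cdots=f(g_kx)\}.$$ Here $G=\mathbb{Z}_2=\langle g\rangle$, so $A(f,2)=\{x\in X : f(x)=f(gx)\}$. *)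

theory Defs
  imports "HOL-Homology.Homology" "HOL-Algebra.Group_Action" "HOL-Library.Z2"
begin

section \<open>Singular cohomology with coefficients in \<open>\<int>\<^sub>2\<close>\<close>

text \<open>
  Cochains are functions on singular simplices with values in the two-element field
  \<^typ>\<open>bit\<close>. They are normalised to be \<open>0\<close> outside the singular simplices of the space, so that
  equality of functions is equality of cochains. No signs occur, as \<open>-1 = 1\<close> in \<open>\<int>\<^sub>2\<close>.
\<close>

type_synonym 'a cochain = "((nat \<Rightarrow> real) \<Rightarrow> 'a) \<Rightarrow> bit"

definition cochain_group :: "nat \<Rightarrow> 'a topology \<Rightarrow> 'a cochain monoid" where
  "cochain_group p X =
     \<lparr>carrier = {a. \<forall>\<sigma>. \<not> singular_simplex p X \<sigma> \<longrightarrow> a \<sigma> = 0},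
      monoid.mult = (\<lambda>a b \<sigma>. a \<sigma> + b \<sigma>),
      one = (\<lambda>\<sigma>. 0)\<rparr>"

definition coboundary :: "nat \<Rightarrow> 'a topology \<Rightarrow> 'a cochain \<Rightarrow> 'a cochain" where
  "coboundary p X a = (\<lambda>\<sigma>. if singular_simplex (Suc p) X \<sigma>
      then \<Sum>k\<le>Suc p. a (singular_face (Suc p) k \<sigma>) else 0)"

definition cocycles :: "nat \<Rightarrow> 'a topology \<Rightarrow> 'a cochain set" where
  "cocycles p X = {a \<in> carrier (cochain_group p X). coboundary p X a = (\<lambda>\<sigma>. 0)}"

fun coboundaries :: "nat \<Rightarrow> 'a topology \<Rightarrow> 'a cochain set" where
  "coboundaries 0 X = {\<lambda>\<sigma>. 0}"
| "coboundaries (Suc p) X = coboundary p X ` carrier (cochain_group p X)"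

definition cocycle_group :: "nat \<Rightarrow> 'a topology \<Rightarrow> 'a cochain monoid" where
  "cocycle_group p X = subgroup_generated (cochain_group p X) (cocycles p X)"

definition cohomology_group :: "nat \<Rightarrow> 'a topology \<Rightarrow> 'a cochain set monoid" where
  "cohomology_group p X = cocycle_group p X Mod coboundaries p X"

definition cohomology_class :: "nat \<Rightarrow> 'a topology \<Rightarrow> 'a cochain \<Rightarrow> 'a cochain set" where
  "cohomology_class p X a = coboundaries p X #>\<^bsub>cocycle_group p X\<^esub> a"

text \<open>The default simp rules rewrite sums and products of bits into \<open>of_bool\<close> expressions.\<close>

declare add_bit_eq_xor [simp del] mult_bit_eq_and [simp del]

lemma carrier_cochain_group:
  "a \<in> carrier (cochain_group p X) \<longleftrightarrow> (\<forall>\<sigma>. \<not> singular_simplex p X \<sigma> \<longrightarrow> a \<sigma> = 0)"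
  by (simp add: cochain_group_def)

lemma mult_cochain_group [simp]: "a \<otimes>\<^bsub>cochain_group p X\<^esub> b = (\<lambda>\<sigma>. a \<sigma> + b \<sigma>)"
  by (simp add: cochain_group_def)

lemma one_cochain_group [simp]: "\<one>\<^bsub>cochain_group p X\<^esub> = (\<lambda>\<sigma>. 0)"
  by (simp add: cochain_group_def)

lemma bit_add_self [simp]: "a + a = (0 :: bit)"
  by (cases a) auto

lemma bit_add_eq_0_iff: "a + b = 0 \<longleftrightarrow> a = (b :: bit)"
  by (cases a; cases b) auto

lemma bit_cancel: "(a + b) + (b + c) = a + (c :: bit)"
  by (cases a; cases b; cases c) auto

lemma comm_group_cochain_group: "comm_group (cochain_group p X)"
proof (rule comm_groupI)
  fix a assume "a \<in> carrier (cochain_group p X)"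
  then show "\<exists>b\<in>carrier (cochain_group p X). b \<otimes>\<^bsub>cochain_group p X\<^esub> a = \<one>\<^bsub>cochain_group p X\<^esub>"
    by (intro bexI[of _ a]) auto
qed (auto simp: carrier_cochain_group add_ac)

lemma inv_cochain_group [simp]:
  assumes "a \<in> carrier (cochain_group p X)"
  shows "inv\<^bsub>cochain_group p X\<^esub> a = a"
proof -
  interpret comm_group "cochain_group p X" by (rule comm_group_cochain_group)
  show ?thesis by (rule inv_equality) (use assms in auto)
qed

lemma coboundary_add:
  "coboundary p X (\<lambda>\<sigma>. a \<sigma> + b \<sigma>) = (\<lambda>\<sigma>. coboundary p X a \<sigma> + coboundary p X b \<sigma>)"
  by (rule ext) (simp only: coboundary_def sum.distrib split: if_split, simp)

lemma coboundary_zero [simp]: "coboundary p X (\<lambda>\<sigma>. 0) = (\<lambda>\<sigma>. 0)"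
  by (auto simp: coboundary_def)

lemma coboundary_in_carrier: "coboundary p X a \<in> carrier (cochain_group (Suc p) X)"
  by (simp add: carrier_cochain_group coboundary_def)

lemma singular_face_face:
  assumes "i \<le> j" "j \<le> Suc p"
  shows "singular_face (Suc p) i (singular_face (Suc (Suc p)) (Suc j) \<sigma>) =
         singular_face (Suc p) j (singular_face (Suc (Suc p)) i \<sigma>)"
proof
  fix t
  show "singular_face (Suc p) i (singular_face (Suc (Suc p)) (Suc j) \<sigma>) t =
        singular_face (Suc p) j (singular_face (Suc (Suc p)) i \<sigma>) t"
  proof (cases "t \<in> standard_simplex p")
    case True
    have "simplical_face i t \<in> standard_simplex (Suc p)"
         "simplical_face j t \<in> standard_simplex (Suc p)"
      using simplical_face_in_standard_simplex[of "Suc p" _ t] True assms by auto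
    moreover have "simplical_face (Suc j) (simplical_face i t) =
        simplical_face i (simplical_face j t)"
      using assms by (fastforce simp: simplical_face_def)
    ultimately show ?thesis
      by (simp add: singular_face_def)
  qed (simp add: singular_face_def)
qed

lemma coboundary_coboundary: "coboundary (Suc p) X (coboundary p X a) = (\<lambda>\<sigma>. 0)"
proof
  fix \<sigma>
  show "coboundary (Suc p) X (coboundary p X a) \<sigma> = 0"
  proof (cases "singular_simplex (Suc (Suc p)) X \<sigma>")
    case True
    define F where "F = (\<lambda>k i. a (singular_face (Suc p) i (singular_face (Suc (Suc p)) k \<sigma>)))"
    let ?S = "{..Suc (Suc p)} \<times> {..Suc p}"
    let ?L = "{(k, i). i < k \<and> k \<le> Suc (Suc p)}" and ?U = "{(k, i). k \<le> i \<and> i \<le> Suc p}"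
    have face: "singular_simplex (Suc p) X (singular_face (Suc (Suc p)) k \<sigma>)"
      if "k \<le> Suc (Suc p)" for k
      using singular_simplex_singular_face[OF True, of k] that by simp
    have fin: "finite ?L" "finite ?U"
      by (rule finite_subset[of _ ?S]; force)+
    have "coboundary (Suc p) X (coboundary p X a) \<sigma> = (\<Sum>k\<le>Suc (Suc p). \<Sum>i\<le>Suc p. F k i)"
      unfolding coboundary_def F_def if_P[OF True]
      by (rule sum.cong) (auto simp only: face if_True atMost_iff)
    also have "\<dots> = (\<Sum>(k, i)\<in>?S. F k i)"
      by (rule sum.cartesian_product)
    also have "?S = ?L \<union> ?U"
      by auto
    also have "(\<Sum>(k, i)\<in>\<dots>. F k i) = (\<Sum>(k, i)\<in>?L. F k i) + (\<Sum>(k, i)\<in>?U. F k i)"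
      by (rule sum.union_disjoint[OF fin]) auto
    also have "(\<Sum>(k, i)\<in>?L. F k i) = (\<Sum>(k, i)\<in>?U. F k i)"
    proof (rule sum.reindex_bij_witness[where i = "\<lambda>(k, i). (Suc i, k)" and j = "\<lambda>(k, i). (i, k - 1)"])
      fix x assume "x \<in> ?L"
      then obtain k i where x: "x = (Suc k, i)" and ki: "i \<le> k" "k \<le> Suc p"
        by (cases x, case_tac a) auto
      show "(case case x of (k, i) \<Rightarrow> (i, k - 1) of (k, i) \<Rightarrow> F k i) = (case x of (k, i) \<Rightarrow> F k i)"
        by (simp add: x F_def singular_face_face[OF ki])
    qed auto
    finally show ?thesis by (simp only: bit_add_self)
  qed (simp add: coboundary_def)
qed

lemma subgroup_cocycles: "subgroup (cocycles p X) (cochain_group p X)"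
proof -
  interpret comm_group "cochain_group p X" by (rule comm_group_cochain_group)
  show ?thesis
    by (rule subgroupI)
      (auto simp: cocycles_def carrier_cochain_group coboundary_add intro: exI[of _ "\<lambda>\<sigma>. 0"])
qed

lemma cocycles_add:
  assumes "a \<in> cocycles p X" "b \<in> cocycles p X"
  shows "(\<lambda>\<sigma>. a \<sigma> + b \<sigma>) \<in> cocycles p X"
  using subgroup.m_closed[OF subgroup_cocycles assms] by simp

lemma cocycle_group_simps [simp]:
  "carrier (cocycle_group p X) = cocycles p X"
  "a \<otimes>\<^bsub>cocycle_group p X\<^esub> b = (\<lambda>\<sigma>. a \<sigma> + b \<sigma>)"
  "\<one>\<^bsub>cocycle_group p X\<^esub> = (\<lambda>\<sigma>. 0)"
proof -
  interpret comm_group "cochain_group p X" by (rule comm_group_cochain_group)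
  show "carrier (cocycle_group p X) = cocycles p X"
    unfolding cocycle_group_def
    by (rule subgroup.carrier_subgroup_generated_subgroup[OF subgroup_cocycles])
qed (simp_all add: cocycle_group_def)

lemma comm_group_cocycle_group: "comm_group (cocycle_group p X)"
  unfolding cocycle_group_def
  by (rule group.abelian_subgroup_generated[OF comm_group.axioms(2)[OF comm_group_cochain_group]
      comm_group_cochain_group])

lemma cocycle_coboundary: "coboundary p X a \<in> cocycles (Suc p) X"
  by (simp add: cocycles_def coboundary_in_carrier coboundary_coboundary)

lemma coboundaries_subset: "coboundaries p X \<subseteq> cocycles p X"
  by (cases p) (auto simp: cocycle_coboundary, simp add: cocycles_def carrier_cochain_group)

lemma coboundaries_zero: "(\<lambda>\<sigma>. 0) \<in> coboundaries p X"
  by (cases p) (auto simp: carrier_cochain_group intro!: rev_image_eqI[where x = "\<lambda>\<sigma>. 0"])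

lemma coboundaries_add:
  assumes "a \<in> coboundaries p X" "b \<in> coboundaries p X"
  shows "(\<lambda>\<sigma>. a \<sigma> + b \<sigma>) \<in> coboundaries p X"
proof (cases p)
  case (Suc n)
  with assms obtain c d where "c \<in> carrier (cochain_group n X)" "d \<in> carrier (cochain_group n X)"
    "a = coboundary n X c" "b = coboundary n X d"
    by auto
  then show ?thesis
    unfolding Suc
    by (auto simp: coboundary_add carrier_cochain_group intro!: image_eqI[where x = "\<lambda>\<sigma>. c \<sigma> + d \<sigma>"])
qed (use assms in auto)

lemma normal_coboundaries: "coboundaries p X \<lhd> cocycle_group p X"
proof -
  interpret comm_group "cocycle_group p X" by (rule comm_group_cocycle_group)
  have inv: "inv\<^bsub>cocycle_group p X\<^esub> a = a" if "a \<in> cocycles p X" for a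
    by (rule inv_equality) (use that in auto)
  have "subgroup (coboundaries p X) (cocycle_group p X)"
  proof (rule subgroupI)
    fix a assume "a \<in> coboundaries p X"
    then show "inv\<^bsub>cocycle_group p X\<^esub> a \<in> coboundaries p X"
      using coboundaries_subset inv by fastforce
    next
    show "coboundaries p X \<noteq> {}"
      using coboundaries_zero by blast
  qed (use coboundaries_subset coboundaries_add in auto)
  then show ?thesis
    by (rule subgroup_imp_normal)
qed

lemma comm_group_cohomology_group: "comm_group (cohomology_group p X)"
  unfolding cohomology_group_def
  using comm_group.abelian_FactGroup[OF comm_group_cocycle_group] normal_coboundaries
    normal_imp_subgroup by blast

lemma carrier_cohomology_group:
  "carrier (cohomology_group p X) = cohomology_class p X ` cocycles p X"
  by (auto simp: cohomology_group_def FactGroup_def RCOSETS_def cohomology_class_def)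

lemma mem_cohomology_class:
  "b \<in> cohomology_class p X a \<longleftrightarrow> (\<lambda>\<sigma>. b \<sigma> + a \<sigma>) \<in> coboundaries p X"
proof
  show "(\<lambda>\<sigma>. b \<sigma> + a \<sigma>) \<in> coboundaries p X" if "b \<in> cohomology_class p X a"
    using that by (auto simp: cohomology_class_def r_coset_def add.assoc)
  show "b \<in> cohomology_class p X a" if "(\<lambda>\<sigma>. b \<sigma> + a \<sigma>) \<in> coboundaries p X"
    using that unfolding cohomology_class_def r_coset_def
    by (auto simp: add.assoc intro!: bexI[where x = "\<lambda>\<sigma>. b \<sigma> + a \<sigma>"])
qed

text \<open>Front \<open>p\<close>-face \<open>\<sigma>[e\<^sub>0, \<dots>, e\<^sub>p]\<close> and back \<open>q\<close>-face \<open>\<sigma>[e\<^sub>p, \<dots>, e\<^bsub>p+q\<^esub>]\<close> of a \<open>(p+q)\<close>-simplex.\<close>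

definition front_face :: "nat \<Rightarrow> ((nat \<Rightarrow> real) \<Rightarrow> 'a) \<Rightarrow> (nat \<Rightarrow> real) \<Rightarrow> 'a" where
  "front_face p \<sigma> = restrict \<sigma> (standard_simplex p)"

definition back_face :: "nat \<Rightarrow> nat \<Rightarrow> ((nat \<Rightarrow> real) \<Rightarrow> 'a) \<Rightarrow> (nat \<Rightarrow> real) \<Rightarrow> 'a" where
  "back_face p q \<sigma> =
     restrict (\<sigma> \<circ> (\<lambda>x i. if i < p then 0 else x (i - p))) (standard_simplex q)"

definition cup :: "nat \<Rightarrow> nat \<Rightarrow> 'a topology \<Rightarrow> 'a cochain \<Rightarrow> 'a cochain \<Rightarrow> 'a cochain" where
  "cup p q X a b = (\<lambda>\<sigma>. if singular_simplex (p + q) X \<sigma>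
      then a (front_face p \<sigma>) * b (back_face p q \<sigma>) else 0)"

text \<open>
  On classes, the union below collapses to the class of \<open>cup p q X a b\<close> for any representatives
  \<open>a \<in> A\<close>, \<open>b \<in> B\<close>; see \<open>cup_class_eq\<close>.
\<close>

definition cup_class ::
    "nat \<Rightarrow> nat \<Rightarrow> 'a topology \<Rightarrow> 'a cochain set \<Rightarrow> 'a cochain set \<Rightarrow> 'a cochain set" where
  "cup_class p q X A B = (\<Union>a\<in>A. \<Union>b\<in>B. cohomology_class (p + q) X (cup p q X a b))"

lemma singular_simplex_comp:
  assumes "singular_simplex n X \<sigma>"
    and "g \<in> standard_simplex m \<rightarrow> standard_simplex n"
    and "\<And>i. continuous_map (subtopology (powertop_real UNIV) (standard_simplex m)) euclideanreal (\<lambda>x. g x i)"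
  shows "singular_simplex m X (restrict (\<sigma> \<circ> g) (standard_simplex m))"
proof -
  have "continuous_map (subtopology (powertop_real UNIV) (standard_simplex m))
      (subtopology (powertop_real UNIV) (standard_simplex n)) g"
    using assms(2,3)
    by (auto simp: continuous_map_in_subtopology continuous_map_componentwise_UNIV)
  then have "continuous_map (subtopology (powertop_real UNIV) (standard_simplex m)) X (\<sigma> \<circ> g)"
    using assms(1) continuous_map_compose unfolding singular_simplex_def by blast
  then show ?thesis
    unfolding singular_simplex_def by (auto intro: continuous_map_eq)
qed

lemma back_simplex:
  assumes "x \<in> standard_simplex q"
  shows "(\<lambda>i. if i < p then 0 else x (i - p)) \<in> standard_simplex (p + q)"
proof -
  have "(\<Sum>i\<le>p + q. if i < p then 0 else x (i - p)) = (\<Sum>i\<in>{p..p + q}. x (i - p))"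
    by (rule sum.mono_neutral_cong_right) auto
  also have "\<dots> = (\<Sum>i\<le>q. x i)"
    by (rule sum.reindex_bij_witness[where i = "\<lambda>i. i + p" and j = "\<lambda>i. i - p"]) auto
  finally show ?thesis
    using assms by (auto simp: standard_simplex_def)
qed

lemma singular_simplex_front_face:
  assumes "singular_simplex (p + q) X \<sigma>"
  shows "singular_simplex p X (front_face p \<sigma>)"
proof -
  have "singular_simplex p X (restrict (\<sigma> \<circ> (\<lambda>x. x)) (standard_simplex p))"
    by (rule singular_simplex_comp[OF assms])
      (use standard_simplex_mono[of p "p + q"] in
        \<open>auto intro: continuous_map_from_subtopology continuous_map_product_projection\<close>)
  then show ?thesis
    by (simp add: front_face_def o_def)
qed

lemma singular_simplex_back_face:
  assumes "singular_simplex (p + q) X \<sigma>"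
  shows "singular_simplex q X (back_face p q \<sigma>)"
  unfolding back_face_def
  by (rule singular_simplex_comp[OF assms])
    (auto simp: back_simplex intro: continuous_map_from_subtopology continuous_map_product_projection)

lemma front_face_face_le:
  assumes "k \<le> Suc p"
  shows "front_face p (singular_face (Suc (p + q)) k \<sigma>) =
         singular_face (Suc p) k (front_face (Suc p) \<sigma>)"
proof
  fix x
  show "front_face p (singular_face (Suc (p + q)) k \<sigma>) x =
         singular_face (Suc p) k (front_face (Suc p) \<sigma>) x"
    using assms standard_simplex_mono[of p "p + q"] simplical_face_in_standard_simplex[of "Suc p" k x]
    by (auto simp: front_face_def singular_face_def)
qed

lemma front_face_face_gt:
  assumes "p < k"
  shows "front_face p (singular_face (Suc (p + q)) k \<sigma>) = front_face p \<sigma>"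
proof
  fix x :: "nat \<Rightarrow> real"
  have "simplical_face k x = x" if "x \<in> standard_simplex p"
    using that assms by (fastforce simp: simplical_face_def standard_simplex_def)
  then show "front_face p (singular_face (Suc (p + q)) k \<sigma>) x = front_face p \<sigma> x"
    using standard_simplex_mono[of p "p + q"]
    by (auto simp: front_face_def singular_face_def)
qed

lemma back_face_face_le:
  assumes "k \<le> p"
  shows "back_face p q (singular_face (Suc (p + q)) k \<sigma>) = back_face (Suc p) q \<sigma>"
proof
  fix x :: "nat \<Rightarrow> real"
  have "simplical_face k (\<lambda>i. if i < p then 0 else x (i - p)) =
      (\<lambda>i. if i < Suc p then 0 else x (i - Suc p))"
    using assms by (fastforce simp: simplical_face_def)
  then show "back_face p q (singular_face (Suc (p + q)) k \<sigma>) x = back_face (Suc p) q \<sigma> x"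
    using back_simplex[of x q p] by (auto simp: back_face_def singular_face_def)
qed

lemma back_face_face_ge:
  assumes "k \<le> Suc q"
  shows "back_face p q (singular_face (Suc (p + q)) (p + k) \<sigma>) =
         singular_face (Suc q) k (back_face p (Suc q) \<sigma>)"
proof
  fix x :: "nat \<Rightarrow> real"
  have "simplical_face (p + k) (\<lambda>i. if i < p then 0 else x (i - p)) =
      (\<lambda>i. if i < p then 0 else simplical_face k x (i - p))"
    by (auto simp: simplical_face_def fun_eq_iff)
  then show "back_face p q (singular_face (Suc (p + q)) (p + k) \<sigma>) x =
         singular_face (Suc q) k (back_face p (Suc q) \<sigma>) x"
    using back_simplex[of x q p] simplical_face_in_standard_simplex[of "Suc q" k x] assms
    by (auto simp: back_face_def singular_face_def)
qed

lemma cup_leibniz: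
  "coboundary (p + q) X (cup p q X a b) =
     (\<lambda>\<sigma>. cup (Suc p) q X (coboundary p X a) b \<sigma> + cup p (Suc q) X a (coboundary q X b) \<sigma>)"
proof
  fix \<sigma>
  show "coboundary (p + q) X (cup p q X a b) \<sigma> =
     cup (Suc p) q X (coboundary p X a) b \<sigma> + cup p (Suc q) X a (coboundary q X b) \<sigma>"
  proof (cases "singular_simplex (Suc (p + q)) X \<sigma>")
    case True
    let ?F = "\<lambda>k. a (singular_face (Suc p) k (front_face (Suc p) \<sigma>)) * b (back_face (Suc p) q \<sigma>)"
    let ?G = "\<lambda>k. a (front_face p \<sigma>) * b (singular_face (Suc q) k (back_face p (Suc q) \<sigma>))"
    let ?H = "\<lambda>k. a (front_face p (singular_face (Suc (p + q)) k \<sigma>)) *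
                   b (back_face p q (singular_face (Suc (p + q)) k \<sigma>))"
    have face: "singular_simplex (p + q) X (singular_face (Suc (p + q)) k \<sigma>)"
      if "k \<le> Suc (p + q)" for k
      using singular_simplex_singular_face[OF True, of k] that by simp
    have fr: "singular_simplex (Suc p) X (front_face (Suc p) \<sigma>)"
      using True by (auto intro: singular_simplex_front_face[of "Suc p" q])
    have bk: "singular_simplex (Suc q) X (back_face p (Suc q) \<sigma>)"
      using True by (auto intro: singular_simplex_back_face)
    have "coboundary (p + q) X (cup p q X a b) \<sigma> = (\<Sum>k\<le>Suc (p + q). ?H k)"
      unfolding coboundary_def if_P[OF True] cup_def
      by (rule sum.cong) (auto simp only: face if_True atMost_iff)
    also have "\<dots> = (\<Sum>k\<in>{..p} \<union> {Suc p..Suc (p + q)}. ?H k)"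
      by (rule sum.cong) auto
    also have "\<dots> = (\<Sum>k\<le>p. ?H k) + (\<Sum>k\<in>{Suc p..Suc (p + q)}. ?H k)"
      by (rule sum.union_disjoint) auto
    also have "(\<Sum>k\<le>p. ?H k) = (\<Sum>k\<le>p. ?F k)"
      by (rule sum.cong) (auto simp: front_face_face_le back_face_face_le)
    also have "(\<Sum>k\<in>{Suc p..Suc (p + q)}. ?H k) = (\<Sum>k\<in>{1..Suc q}. ?G k)"
    proof (rule sum.reindex_bij_witness[where i = "\<lambda>k. p + k" and j = "\<lambda>k. k - p"])
      fix k assume k: "k \<in> {Suc p..Suc (p + q)}"
      then show "?G (k - p) = ?H k"
        using back_face_face_ge[of "k - p" q p \<sigma>] front_face_face_gt[of p k q \<sigma>] by auto
    qed auto
    also have "?F (Suc p) = ?G 0"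
      using front_face_face_le[of "Suc p" p q \<sigma>] front_face_face_gt[of p "Suc p" q \<sigma>]
        back_face_face_ge[of 0 q p \<sigma>] back_face_face_le[of p p q \<sigma>] by simp
    then have "(\<Sum>k\<le>p. ?F k) + (\<Sum>k\<in>{1..Suc q}. ?G k) =
        ((\<Sum>k\<le>p. ?F k) + ?F (Suc p)) + (?G 0 + (\<Sum>k\<in>{1..Suc q}. ?G k))"
      by (simp only: bit_cancel)
    also have "\<dots> = (\<Sum>k\<le>Suc p. ?F k) + (\<Sum>k\<le>Suc q. ?G k)"
    proof -
      have "{..Suc q} = insert 0 {1..Suc q}" by auto
      then have "(\<Sum>k\<le>Suc q. ?G k) = (\<Sum>k\<in>insert 0 {1..Suc q}. ?G k)" by (rule arg_cong)
      also have "\<dots> = ?G 0 + (\<Sum>k\<in>{1..Suc q}. ?G k)" by (rule sum.insert) auto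
      finally have "(\<Sum>k\<le>Suc q. ?G k) = ?G 0 + (\<Sum>k\<in>{1..Suc q}. ?G k)" .
      then show ?thesis by (simp only: sum.atMost_Suc)
    qed
    finally show ?thesis
      using True fr bk
      by (simp only: cup_def coboundary_def if_True add_Suc add_Suc_right sum_distrib_left sum_distrib_right)
  qed (simp add: coboundary_def cup_def)
qed

lemma cup_in_carrier: "cup p q X a b \<in> carrier (cochain_group (p + q) X)"
  by (simp add: carrier_cochain_group cup_def)

lemma cup_zero [simp]:
  "cup p q X (\<lambda>\<sigma>. 0) b = (\<lambda>\<sigma>. 0)" "cup p q X a (\<lambda>\<sigma>. 0) = (\<lambda>\<sigma>. 0)"
  by (auto simp: cup_def)

lemma cup_add_left:
  "cup p q X (\<lambda>\<sigma>. a \<sigma> + a' \<sigma>) b = (\<lambda>\<sigma>. cup p q X a b \<sigma> + cup p q X a' b \<sigma>)"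
  by (auto simp: cup_def algebra_simps)

lemma cup_add_right:
  "cup p q X a (\<lambda>\<sigma>. b \<sigma> + b' \<sigma>) = (\<lambda>\<sigma>. cup p q X a b \<sigma> + cup p q X a b' \<sigma>)"
  by (auto simp: cup_def algebra_simps)

lemma cup_cocycles:
  assumes "a \<in> cocycles p X" "b \<in> cocycles q X"
  shows "cup p q X a b \<in> cocycles (p + q) X"
  using assms by (simp add: cocycles_def cup_in_carrier cup_leibniz)

lemma cup_coboundaries_left:
  assumes "a \<in> coboundaries p X" "b \<in> cocycles q X"
  shows "cup p q X a b \<in> coboundaries (p + q) X"
proof (cases p)
  case (Suc n)
  with assms obtain c where "a = coboundary n X c" by auto
  then have "cup p q X a b = coboundary (n + q) X (cup n q X c b)"
    using assms by (simp add: Suc cup_leibniz cocycles_def)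
  then show ?thesis
    by (simp add: Suc cup_in_carrier)
qed (use assms coboundaries_zero[of q X] in auto)

lemma cup_coboundaries_right:
  assumes "a \<in> cocycles p X" "b \<in> coboundaries q X"
  shows "cup p q X a b \<in> coboundaries (p + q) X"
proof (cases q)
  case (Suc n)
  with assms obtain c where "b = coboundary n X c" by auto
  then have "cup p q X a b = coboundary (p + n) X (cup p n X a c)"
    using assms by (simp add: Suc cup_leibniz cocycles_def)
  then show ?thesis
    by (simp add: Suc cup_in_carrier)
qed (use assms coboundaries_zero[of p X] in auto)

lemma cohomology_class_eq:
  assumes "b \<in> cohomology_class p X a"
  shows "cohomology_class p X b = cohomology_class p X a"
proof -
  have ba: "(\<lambda>\<sigma>. b \<sigma> + a \<sigma>) \<in> coboundaries p X"
    using assms by (simp add: mem_cohomology_class)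
  then have ab: "(\<lambda>\<sigma>. a \<sigma> + b \<sigma>) \<in> coboundaries p X"
    by (simp add: add.commute)
  have "c \<in> cohomology_class p X b \<longleftrightarrow> c \<in> cohomology_class p X a" for c
    using coboundaries_add[OF _ ba, of "\<lambda>\<sigma>. c \<sigma> + b \<sigma>"]
      coboundaries_add[OF _ ab, of "\<lambda>\<sigma>. c \<sigma> + a \<sigma>"]
    by (auto simp: mem_cohomology_class bit_cancel)
  then show ?thesis by blast
qed

lemma cup_class_eq:
  assumes a: "a \<in> cocycles p X" and b: "b \<in> cocycles q X"
  shows "cup_class p q X (cohomology_class p X a) (cohomology_class q X b) =
         cohomology_class (p + q) X (cup p q X a b)"
proof -
  have "cohomology_class (p + q) X (cup p q X a' b') = cohomology_class (p + q) X (cup p q X a b)"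
    if a': "a' \<in> cohomology_class p X a" and b': "b' \<in> cohomology_class q X b" for a' b'
  proof (rule cohomology_class_eq)
    have da: "(\<lambda>\<sigma>. a' \<sigma> + a \<sigma>) \<in> coboundaries p X" and db: "(\<lambda>\<sigma>. b' \<sigma> + b \<sigma>) \<in> coboundaries q X"
      using a' b' by (simp_all add: mem_cohomology_class)
    have "(\<lambda>\<sigma>. (b' \<sigma> + b \<sigma>) + b \<sigma>) \<in> cocycles q X"
      using cocycles_add[OF subsetD[OF coboundaries_subset db] b] .
    then have "b' \<in> cocycles q X"
      by (simp add: add.assoc)
    then have "(\<lambda>\<sigma>. cup p q X (\<lambda>\<sigma>. a' \<sigma> + a \<sigma>) b' \<sigma> + cup p q X a (\<lambda>\<sigma>. b' \<sigma> + b \<sigma>) \<sigma>)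
        \<in> coboundaries (p + q) X"
      by (intro coboundaries_add cup_coboundaries_left cup_coboundaries_right da db a)
    moreover have "cup p q X (\<lambda>\<sigma>. a' \<sigma> + a \<sigma>) b' \<sigma> + cup p q X a (\<lambda>\<sigma>. b' \<sigma> + b \<sigma>) \<sigma> =
        cup p q X a' b' \<sigma> + cup p q X a b \<sigma>" for \<sigma>
      unfolding cup_add_left cup_add_right
      by (rule bit_cancel)
    ultimately show "cup p q X a' b' \<in> cohomology_class (p + q) X (cup p q X a b)"
      by (simp add: mem_cohomology_class)
  qed
  moreover have "a \<in> cohomology_class p X a" "b \<in> cohomology_class q X b"
    by (simp_all add: mem_cohomology_class coboundaries_zero)
  ultimately show ?thesis
    unfolding cup_class_def by blast
qed

definition unit_class :: "'a topology \<Rightarrow> 'a cochain set" where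
  "unit_class X = cohomology_class 0 X (\<lambda>\<sigma>. if singular_simplex 0 X \<sigma> then 1 else 0)"

text \<open>
  Isomorphism of the graded algebras \<open>H\<^sup>*(X; \<int>\<^sub>2)\<close> and \<open>H\<^sup>*(Y; \<int>\<^sub>2)\<close>, written degree by degree.
  Additive maps are automatically linear over the prime field \<open>\<int>\<^sub>2\<close>.
\<close>

definition mod2_cohomology_iso :: "'a topology \<Rightarrow> 'b topology \<Rightarrow> bool" (infix \<open>\<simeq>\<^sub>2\<close> 50) where
  "X \<simeq>\<^sub>2 Y \<longleftrightarrow>
     (\<exists>h :: nat \<Rightarrow> 'a cochain set \<Rightarrow> 'b cochain set.
        (\<forall>p. h p \<in> iso (cohomology_group p X) (cohomology_group p Y)) \<and>
        (\<forall>p q. \<forall>A \<in> carrier (cohomology_group p X). \<forall>B \<in> carrier (cohomology_group q X).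
            h (p + q) (cup_class p q X A B) = cup_class p q Y (h p A) (h q B)) \<and>
        h 0 (unit_class X) = unit_class Y)"


section \<open>Complex projective spaces and complex Milnor manifolds\<close>

definition quotient_topology :: "'a topology \<Rightarrow> ('a \<Rightarrow> 'b) \<Rightarrow> 'b topology" where
  "quotient_topology X q =
     topology (\<lambda>U. U \<subseteq> q ` topspace X \<and> openin X {x \<in> topspace X. q x \<in> U})"

lemma istopology_quotient:
  "istopology (\<lambda>U. U \<subseteq> q ` topspace X \<and> openin X {x \<in> topspace X. q x \<in> U})"
proof -
  have "{x \<in> topspace X. q x \<in> S \<inter> T} =
      {x \<in> topspace X. q x \<in> S} \<inter> {x \<in> topspace X. q x \<in> T}" for S T
    by auto
  moreover have "{x \<in> topspace X. q x \<in> \<Union>K} = (\<Union>S\<in>K. {x \<in> topspace X. q x \<in> S})" for K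
    by auto
  ultimately show ?thesis
    unfolding istopology_def by auto
qed

lemma openin_quotient_topology:
  "openin (quotient_topology X q) U \<longleftrightarrow>
     U \<subseteq> q ` topspace X \<and> openin X {x \<in> topspace X. q x \<in> U}"
  unfolding quotient_topology_def topology_inverse'[OF istopology_quotient] ..

lemma topspace_quotient_topology: "topspace (quotient_topology X q) = q ` topspace X"
proof -
  have "{x \<in> topspace X. q x \<in> q ` topspace X} = topspace X"
    by auto
  then have "openin (quotient_topology X q) (q ` topspace X)"
    by (simp add: openin_quotient_topology)
  then show ?thesis
    by (meson openin_quotient_topology openin_subset openin_topspace subset_antisym)
qed

lemma quotient_map_quotient_topology: "quotient_map X (quotient_topology X q) q"
  by (auto simp: quotient_map_def topspace_quotient_topology openin_quotient_topology)

text \<open>\<open>\<complex>\<^bsup>r+1\<^esup> - {0}\<close>, with coordinates indexed by \<open>0, \<dots>, r\<close>; tuples are \<open>undefined\<close> beyond \<open>r\<close>.\<close>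

definition punctured_space :: "nat \<Rightarrow> (nat \<Rightarrow> complex) topology" where
  "punctured_space r =
     subtopology (product_topology (\<lambda>i. euclidean) {..r}) (- {\<lambda>i\<in>{..r}. 0})"

definition homogeneous :: "nat \<Rightarrow> (nat \<Rightarrow> complex) \<Rightarrow> (nat \<Rightarrow> complex) set" where
  "homogeneous r z = {(\<lambda>i\<in>{..r}. c * z i) | c. c \<noteq> 0}"

definition complex_projective_space :: "nat \<Rightarrow> (nat \<Rightarrow> complex) set topology" where
  "complex_projective_space r = quotient_topology (punctured_space r) (homogeneous r)"

text \<open>
  The defining equation is invariant under rescaling \<open>z\<close> and \<open>w\<close>, so it does not matter which
  homogeneous coordinates are used. It refers to \<open>z\<^sub>0, \<dots>, z\<^sub>s\<close> and is meant for \<open>s \<le> r\<close>.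
\<close>

definition milnor_manifold ::
    "nat \<Rightarrow> nat \<Rightarrow> ((nat \<Rightarrow> complex) set \<times> (nat \<Rightarrow> complex) set) topology" where
  "milnor_manifold r s =
     subtopology (prod_topology (complex_projective_space r) (complex_projective_space s))
       {(homogeneous r z, homogeneous s w) | z w.
          z \<in> topspace (punctured_space r) \<and> w \<in> topspace (punctured_space s) \<and>
          (\<Sum>i\<le>s. z i * cnj (w i)) = 0}"


section \<open>Group actions and coincidence sets\<close>

text \<open>Intended for finite (discrete) groups, where continuity is required elementwise.\<close>

definition topological_action ::
    "('g, 'm) monoid_scheme \<Rightarrow> 'a topology \<Rightarrow> ('g \<Rightarrow> 'a \<Rightarrow> 'a) \<Rightarrow> bool" where
  "topological_action G X \<phi> \<longleftrightarrow>
     group_action G (topspace X) \<phi> \<and> (\<forall>g \<in> carrier G. continuous_map X X (\<phi> g))"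

definition free_action ::
    "('g, 'm) monoid_scheme \<Rightarrow> 'a topology \<Rightarrow> ('g \<Rightarrow> 'a \<Rightarrow> 'a) \<Rightarrow> bool" where
  "free_action G X \<phi> \<longleftrightarrow>
     topological_action G X \<phi> \<and>
     (\<forall>g \<in> carrier G. \<forall>x \<in> topspace X. \<phi> g x = x \<longrightarrow> g = \<one>\<^bsub>G\<^esub>)"

definition coincidence_set ::
    "('g, 'm) monoid_scheme \<Rightarrow> 'a topology \<Rightarrow> ('g \<Rightarrow> 'a \<Rightarrow> 'a) \<Rightarrow> ('a \<Rightarrow> 'b) \<Rightarrow> nat \<Rightarrow> 'a set" where
  "coincidence_set G X \<phi> f k =
     {x \<in> topspace X. \<exists>gs. distinct gs \<and> length gs = k \<and> set gs \<subseteq> carrier G \<and>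
        (\<forall>g \<in> set gs. \<forall>h \<in> set gs. f (\<phi> g x) = f (\<phi> h x))}"

end

(*
  If f has no coincidence, then F(x) = f(x) - f(gx) maps X to C - {0} with F(gx) = -F(x). The
  integral class pulled back from the circle along F, reduced mod 2, is represented by a cocycle
  counting by how much a continuous logarithm of F along an edge differs from the principal one.
  On a loop made of a path from x to gx and of its g-translate this cocycle has the value 1, so
  H^1(X; Z_2) is not zero. But X is path connected with H^1(X; Z_2) = 0, because the Milnor
  manifold is: it is covered by the sets {z_i w_j nonzero}, i and j distinct, which are
  contractible, share a point and have path connected pairwise intersections, so that potentials
  of a 1-cocycle on these sets, normalised at the common point, glue.
*)

theory Submission
  imports Defs "HOL-Analysis.Further_Topology" "HOL-Computational_Algebra.Polynomial"
begin

section \<open>Evaluation of cochains on chains\<close>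

text \<open>Degrees 0 and 1 of the isomorphism carry the proof: degree 0 detects that X is non-empty
  and path connected, degree 1 excludes the winding class. Homology is integral here, while
  cohomology is mod 2 and given by cochains. Evaluating cochains mod 2 on integral chains makes
  subdivision and the vanishing homology of contractible spaces available. Universal coefficients
  are replaced by an elementary fact: in degree 1, on a path connected space, a cochain that
  vanishes on cycles has a potential, found by integrating along paths. Charts with i = j are left
  out since, after normalisation, the equation there reads 1 + (other terms) = 0, which scaling the
  remaining coordinates does not preserve. For distinct i and j it can be solved for the coordinate
  z_j. The principal logarithm is discontinuous, but it is subtracted only at end points, that is,
  as the coboundary of a 0-cochain. This turns the change of a continuous logarithm into a multiple
  of \<open>2 * pi * \<i>\<close> and keeps it additive on triangles.\<close>

definition chain_eval :: "'a cochain \<Rightarrow> 'a chain \<Rightarrow> bit" where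
  "chain_eval a c = (\<Sum>\<sigma>\<in>Poly_Mapping.keys c. of_int (Poly_Mapping.lookup c \<sigma>) * a \<sigma>)"

lemma chain_eval_superset:
  assumes "finite S" "Poly_Mapping.keys c \<subseteq> S"
  shows "chain_eval a c = (\<Sum>\<sigma>\<in>S. of_int (Poly_Mapping.lookup c \<sigma>) * a \<sigma>)"
  unfolding chain_eval_def
  by (rule sum.mono_neutral_left) (use assms in \<open>auto simp: in_keys_iff\<close>)

lemma chain_eval_add: "chain_eval a (c + d) = chain_eval a c + chain_eval a d"
proof -
  let ?S = "Poly_Mapping.keys c \<union> Poly_Mapping.keys d"
  have "chain_eval a (c + d) = (\<Sum>\<sigma>\<in>?S. of_int (Poly_Mapping.lookup (c + d) \<sigma>) * a \<sigma>)"
    by (rule chain_eval_superset) (use Poly_Mapping.keys_add[of c d] in auto)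
  also have "\<dots> = (\<Sum>\<sigma>\<in>?S. of_int (Poly_Mapping.lookup c \<sigma>) * a \<sigma>)
      + (\<Sum>\<sigma>\<in>?S. of_int (Poly_Mapping.lookup d \<sigma>) * a \<sigma>)"
    by (simp add: lookup_add distrib_right sum.distrib)
  also have "\<dots> = chain_eval a c + chain_eval a d"
    by (intro arg_cong2[where f = "(+)"] chain_eval_superset[symmetric]) auto
  finally show ?thesis .
qed

lemma chain_eval_0 [simp]: "chain_eval a 0 = 0"
  by (simp add: chain_eval_def)

lemma chain_eval_diff: "chain_eval a (c - d) = chain_eval a c + chain_eval a d"
proof -
  have "chain_eval a c = chain_eval a (c - d) + chain_eval a d"
    by (simp flip: chain_eval_add)
  then show ?thesis
    by (simp add: add.assoc)
qed

lemma chain_eval_of [simp]: "chain_eval a (frag_of \<sigma>) = a \<sigma>"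
  by (simp add: chain_eval_def)

lemma chain_eval_sum: "chain_eval a (sum f I) = (\<Sum>i\<in>I. chain_eval a (f i))"
  by (induction I rule: infinite_finite_induct) (auto simp: chain_eval_add)

lemma chain_eval_signed_of: "chain_eval a (frag_cmul ((-1) ^ k) (frag_of \<sigma>)) = a \<sigma>"
  using chain_eval_diff[of a 0 "frag_of \<sigma>"] by (cases "even k") auto

lemma chain_eval_cong:
  assumes "\<And>\<sigma>. \<sigma> \<in> Poly_Mapping.keys c \<Longrightarrow> a \<sigma> = b \<sigma>"
  shows "chain_eval a c = chain_eval b c"
  unfolding chain_eval_def by (rule sum.cong) (auto simp: assms)

text \<open>A discrete Stokes formula. By linearity one simplex suffices, and there the alternating
  signs of the boundary disappear mod 2.\<close>

lemma chain_eval_boundary: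
  assumes "singular_chain (Suc p) X c"
  shows "chain_eval a (chain_boundary (Suc p) c) = chain_eval (coboundary p X a) c"
  using assms unfolding singular_chain_def
proof (induction rule: frag_induction)
  case (one \<sigma>)
  then show ?case
    by (simp only: chain_boundary_of chain_eval_sum chain_eval_signed_of chain_eval_of
        coboundary_def mem_Collect_eq if_True nat.distinct if_False)
qed (auto simp: chain_boundary_diff chain_eval_diff)

lemma chain_eval_cocycle_boundary:
  assumes "a \<in> cocycles p X" "singular_relboundary p X {} c"
  shows "chain_eval a c = 0"
proof -
  obtain d where "singular_chain (Suc p) X d" "chain_boundary (Suc p) d = c"
    using assms(2) unfolding singular_boundary by blast
  moreover have "chain_eval (\<lambda>\<sigma>. 0) d = 0"
    by (simp add: chain_eval_def)
  ultimately show ?thesis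
    using assms(1) chain_eval_boundary[of p X d a] by (simp add: cocycles_def)
qed

section \<open>Cocycles in degrees zero and one\<close>

abbreviation vertex :: "nat \<Rightarrow> nat \<Rightarrow> real" where
  "vertex k \<equiv> (\<lambda>j. if j = k then 1 else 0)"

definition point_simplex :: "'a \<Rightarrow> (nat \<Rightarrow> real) \<Rightarrow> 'a" where
  "point_simplex x = (\<lambda>t\<in>standard_simplex 0. x)"

definition path_simplex :: "(real \<Rightarrow> 'a) \<Rightarrow> (nat \<Rightarrow> real) \<Rightarrow> 'a" where
  "path_simplex \<gamma> = (\<lambda>t\<in>standard_simplex 1. \<gamma> (t 1))"

lemma singular_simplex_0_iff:
  "singular_simplex 0 X \<sigma> \<longleftrightarrow> (\<exists>x\<in>topspace X. \<sigma> = point_simplex x)"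
proof
  assume L: "singular_simplex 0 X \<sigma>"
  then have "\<sigma> (vertex 0) \<in> topspace X"
    unfolding singular_simplex_def continuous_map_def by auto
  moreover have "\<sigma> t = point_simplex (\<sigma> (vertex 0)) t" for t
    using L by (auto simp: singular_simplex_def point_simplex_def standard_simplex_0 extensional_def)
  ultimately show "\<exists>x\<in>topspace X. \<sigma> = point_simplex x"
    by blast
next
  assume "\<exists>x\<in>topspace X. \<sigma> = point_simplex x"
  then show "singular_simplex 0 X \<sigma>"
    by (auto simp: singular_simplex_def point_simplex_def)
qed

lemma point_simplex_inject [simp]: "point_simplex x = point_simplex y \<longleftrightarrow> x = y"
  by (metis point_simplex_def nonempty_standard_simplex restrict_apply' ex_in_conv)

text \<open>The k-th face omits vertex k, so face 0 is the end of the edge and face 1 its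
  start.\<close>

lemma singular_face_1:
  "singular_face 1 0 \<sigma> = point_simplex (\<sigma> (vertex 1))"
  "singular_face 1 1 \<sigma> = point_simplex (\<sigma> (vertex 0))"
  "singular_face (Suc 0) 0 \<sigma> = point_simplex (\<sigma> (vertex (Suc 0)))"
  "singular_face (Suc 0) (Suc 0) \<sigma> = point_simplex (\<sigma> (vertex 0))"
proof -
  have "simplical_face 0 (vertex 0) = (vertex 1 :: nat \<Rightarrow> real)"
    "simplical_face 1 (vertex 0) = (vertex 0 :: nat \<Rightarrow> real)"
    by (auto simp: simplical_face_def fun_eq_iff)
  then show "singular_face 1 0 \<sigma> = point_simplex (\<sigma> (vertex 1))"
    "singular_face 1 1 \<sigma> = point_simplex (\<sigma> (vertex 0))"
    by (auto simp: singular_face_def point_simplex_def standard_simplex_0 simp del: One_nat_def)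
  then show "singular_face (Suc 0) 0 \<sigma> = point_simplex (\<sigma> (vertex (Suc 0)))"
    "singular_face (Suc 0) (Suc 0) \<sigma> = point_simplex (\<sigma> (vertex 0))"
    by simp_all
qed

lemma coboundary_0:
  assumes "singular_simplex 1 X \<sigma>"
  shows "coboundary 0 X a \<sigma> = a (point_simplex (\<sigma> (vertex 1))) + a (point_simplex (\<sigma> (vertex 0)))"
  using assms by (simp add: coboundary_def singular_face_1)

lemma chain_boundary_1:
  "chain_boundary 1 (frag_of \<sigma>) =
     frag_of (point_simplex (\<sigma> (vertex 1))) - frag_of (point_simplex (\<sigma> (vertex 0)))"
  by (simp add: chain_boundary_of singular_face_1)

lemma singular_simplex_path_simplex:
  assumes "pathin X \<gamma>"
  shows "singular_simplex 1 X (path_simplex \<gamma>)"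
proof -
  have "continuous_map (subtopology (powertop_real UNIV) (standard_simplex 1))
      (top_of_set {0..1}) (\<lambda>t. t 1)"
    by (auto simp: continuous_map_in_subtopology standard_simplex_def
        intro!: continuous_map_from_subtopology continuous_map_product_projection)
  then have "continuous_map (subtopology (powertop_real UNIV) (standard_simplex 1)) X (\<gamma> \<circ> (\<lambda>t. t 1))"
    using assms unfolding pathin_def by (rule continuous_map_compose)
  then show ?thesis
    unfolding singular_simplex_def path_simplex_def by (auto intro: continuous_map_eq)
qed

lemma path_simplex_ends [simp]:
  "path_simplex \<gamma> (vertex 0) = \<gamma> 0" "path_simplex \<gamma> (vertex 1) = \<gamma> 1"
  "path_simplex \<gamma> (vertex (Suc 0)) = \<gamma> 1"
  by (auto simp: path_simplex_def)

text \<open>Runs through the standard 1-simplex with the barycentric coordinate of vertex 1 as time,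
  as in \<open>path_simplex\<close>, so that a singular 1-simplex can be read as a path.\<close>

definition edge_point :: "real \<Rightarrow> nat \<Rightarrow> real" where
  "edge_point t = (\<lambda>i. if i = 0 then 1 - t else if i = 1 then t else 0)"

lemma edge_point_ends: "edge_point 0 = vertex 0" "edge_point 1 = vertex 1"
  by (auto simp: edge_point_def fun_eq_iff)

lemma edge_point_simplex: "t \<in> {0..1} \<Longrightarrow> edge_point t \<in> standard_simplex 1"
  by (auto simp: edge_point_def standard_simplex_def)

lemma pathin_edge:
  assumes "singular_simplex 1 X \<sigma>"
  shows "pathin X (\<lambda>t. \<sigma> (edge_point t))"
proof -
  have "continuous_on {0..1} (\<lambda>t. edge_point t k)" for k
    unfolding edge_point_def by (cases "k = 0"; cases "k = 1") (auto intro!: continuous_intros)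
  then have "continuous_map (top_of_set {0..1}) (powertop_real UNIV) edge_point"
    by (simp only: continuous_map_componentwise_UNIV continuous_map_iff_continuous simp_thms)
  then have "continuous_map (top_of_set {0..1})
      (subtopology (powertop_real UNIV) (standard_simplex 1)) edge_point"
    by (simp add: continuous_map_in_subtopology edge_point_simplex del: One_nat_def)
  then have "continuous_map (top_of_set {0..1}) X (\<sigma> \<circ> edge_point)"
    using assms unfolding singular_simplex_def by (blast intro: continuous_map_compose)
  then show ?thesis
    by (simp add: pathin_def o_def)
qed

lemma singular_simplex_1_vertex:
  assumes "singular_simplex 1 X \<sigma>" "k \<le> 1"
  shows "\<sigma> (vertex k) \<in> topspace X"
proof -
  have "vertex k \<in> standard_simplex 1" using assms by simp
  then show ?thesis
    using assms(1) unfolding singular_simplex_def continuous_map_def by auto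
qed

text \<open>Only the edges of \<open>X\<close> are tested, so a cochain of a larger space can have a
  potential on a subspace without being restricted to it. No continuity of \<open>h\<close> is asked
  for, as 0-cochains are arbitrary functions on points.\<close>

definition potential_of :: "'a topology \<Rightarrow> ('a \<Rightarrow> bit) \<Rightarrow> 'a cochain \<Rightarrow> bool" where
  "potential_of X h a \<longleftrightarrow>
     (\<forall>\<sigma>. singular_simplex 1 X \<sigma> \<longrightarrow> a \<sigma> = h (\<sigma> (vertex 1)) + h (\<sigma> (vertex 0)))"

lemma coboundaries_1_potential:
  assumes "a \<in> coboundaries 1 X"
  obtains h where "potential_of X h a"
proof -
  obtain b where "a = coboundary 0 X b"
    using assms by auto
  then have "potential_of X (\<lambda>x. b (point_simplex x)) a"
    by (auto simp: potential_of_def coboundary_0)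
  with that show thesis .
qed

definition point_cochain :: "'a topology \<Rightarrow> ('a \<Rightarrow> bit) \<Rightarrow> 'a cochain" where
  "point_cochain X h = (\<lambda>\<sigma>. if singular_simplex 0 X \<sigma> then h (\<sigma> (vertex 0)) else 0)"

lemma point_cochain_in_carrier: "point_cochain X h \<in> carrier (cochain_group 0 X)"
  by (simp add: carrier_cochain_group point_cochain_def)

lemma point_cochain_point [simp]:
  "x \<in> topspace X \<Longrightarrow> point_cochain X h (point_simplex x) = h x"
  by (auto simp: point_cochain_def singular_simplex_0_iff) (simp add: point_simplex_def)

lemma coboundary_point_cochain:
  assumes "singular_simplex 1 X \<sigma>"
  shows "coboundary 0 X (point_cochain X h) \<sigma> = h (\<sigma> (vertex 1)) + h (\<sigma> (vertex 0))"
  using assms singular_simplex_1_vertex[OF assms]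
  by (simp only: coboundary_0 point_cochain_point le_refl zero_le)

lemma potential_coboundaries_1:
  assumes "a \<in> carrier (cochain_group 1 X)" "potential_of X h a"
  shows "a \<in> coboundaries 1 X"
proof -
  have "a \<sigma> = coboundary 0 X (point_cochain X h) \<sigma>" for \<sigma>
  proof (cases "singular_simplex 1 X \<sigma>")
    case True
    with assms(2) show ?thesis
      by (simp only: potential_of_def coboundary_point_cochain)
  next
    case False
    with assms(1) show ?thesis
      by (simp add: carrier_cochain_group coboundary_def)
  qed
  then have "a = coboundary 0 X (point_cochain X h)" by blast
  then show ?thesis
    using point_cochain_in_carrier by auto
qed

text \<open>The potential at a point is the integral of \<open>a\<close> along a chosen path from
  \<open>x0\<close>. It is finally shifted by a constant, which no difference notices, to vanish at
  \<open>x0\<close>.\<close>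

lemma potential_of_vanishing_on_cycles:
  assumes X: "path_connected_space X" and x0: "x0 \<in> topspace X"
    and a: "\<And>c. singular_relcycle 1 X {} c \<Longrightarrow> chain_eval a c = 0"
  obtains h where "potential_of X h a" "h x0 = 0"
proof -
  have "\<exists>\<gamma>. pathin X \<gamma> \<and> \<gamma> 0 = x0 \<and> \<gamma> 1 = x" if "x \<in> topspace X" for x
    using X x0 that unfolding path_connected_space_def by blast
  then obtain P where P: "\<And>x. x \<in> topspace X \<Longrightarrow> pathin X (P x) \<and> P x 0 = x0 \<and> P x 1 = x"
    by metis
  define h where "h x = a (path_simplex (P x))" for x
  have "a \<sigma> = h (\<sigma> (vertex 1)) + h (\<sigma> (vertex 0))" if \<sigma>: "singular_simplex 1 X \<sigma>" for \<sigma>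
  proof -
    define x y where "x = \<sigma> (vertex 0)" and "y = \<sigma> (vertex 1)"
    have xy: "x \<in> topspace X" "y \<in> topspace X"
      unfolding x_def y_def by (auto intro!: singular_simplex_1_vertex[OF \<sigma>])
    \<comment> \<open>The closed loop that goes from \<open>x0\<close> to \<open>x\<close>, along
      \<sigma> to \<open>y\<close>, and back along the path chosen for \<open>y\<close>.\<close>
    define c where "c = frag_of (path_simplex (P x)) + frag_of \<sigma> - frag_of (path_simplex (P y))"
    have "singular_chain 1 X c"
      unfolding c_def using \<sigma> P[OF xy(1)] P[OF xy(2)]
      by (intro singular_chain_add singular_chain_diff)
        (auto simp: singular_chain_of simp del: One_nat_def intro: singular_simplex_path_simplex)
    moreover have "chain_boundary 1 c = 0"
      unfolding c_def chain_boundary_add chain_boundary_diff chain_boundary_1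
      using P[OF xy(1)] P[OF xy(2)] by (simp only: path_simplex_ends x_def y_def) simp
    ultimately have "chain_eval a c = 0"
      by (intro a) (simp add: singular_cycle)
    then have "h x + a \<sigma> + h y = 0"
      by (simp add: c_def chain_eval_add chain_eval_diff h_def)
    then have "a \<sigma> = h y + h x"
      by (cases "h x"; cases "h y"; cases "a \<sigma>") auto
    then show ?thesis
      unfolding x_def y_def .
  qed
  then have "potential_of X h a"
    by (simp add: potential_of_def)
  moreover have "potential_of X (\<lambda>x. h x + h x0) a"
    using calculation unfolding potential_of_def
    by (simp only: bit_cancel[of _ "h x0" "h _", unfolded add.commute[of "h x0"]])
  ultimately show thesis
    using that[of "\<lambda>x. h x + h x0"] by simp
qed

section \<open>Gluing potentials over a cover by contractible sets\<close>

lemma contractible_cycle_boundary: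
  assumes "contractible_space X" "p \<ge> 1" "singular_relcycle p X {} c"
  shows "singular_relboundary p X {} c"
proof -
  have "trivial_group (homology_group (int p) X)"
    using trivial_reduced_homology_group_contractible_space[OF assms(1), of "int p"]
      un_reduced_homology_group[of "int p" X] assms(2) by simp
  then have "homologous_rel_set p X {} ` singular_relcycle_set p X {} = {singular_relboundary_set p X {}}"
    unfolding trivial_group_def carrier_relative_homology_group one_relative_homology_group by simp
  then have "homologous_rel_set p X {} c = singular_relboundary_set p X {}"
    by (metis assms(3) imageI mem_Collect_eq singletonD)
  then show ?thesis
    by (simp only: homologous_rel_set_eq_relboundary)
qed

text \<open>Contractibility turns each cycle of \<open>U\<close> into a boundary, where a cocycle
  vanishes, so local potentials exist. A potential is unique up to one constant per path component,
  hence the common point and the path connected intersections force agreement.\<close>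

lemma contractible_cover_coboundaries_1:
  assumes op: "\<And>U. U \<in> \<U> \<Longrightarrow> openin X U" and cover: "topspace X \<subseteq> \<Union>\<U>"
    and x0: "\<And>U. U \<in> \<U> \<Longrightarrow> x0 \<in> U" "x0 \<in> topspace X"
    and contr: "\<And>U. U \<in> \<U> \<Longrightarrow> contractible_space (subtopology X U)"
    and inter: "\<And>U V. U \<in> \<U> \<Longrightarrow> V \<in> \<U> \<Longrightarrow> path_connectedin X (U \<inter> V)"
  shows "path_connected_space X" "cocycles 1 X \<subseteq> coboundaries 1 X"
proof -
  have sub: "U \<subseteq> topspace X" if "U \<in> \<U>" for U
    using op[OF that] by (rule openin_subset)
  have pcU: "path_connectedin X U" if "U \<in> \<U>" for U
    using inter[OF that that] by simp
  have "x0 \<in> \<Inter>\<U>"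
    using x0(1) by blast
  then have "path_connectedin X (\<Union>\<U>)"
    by (intro path_connectedin_Union pcU) auto
  moreover have "\<Union>\<U> = topspace X"
    using cover sub by blast
  ultimately show pc: "path_connected_space X"
    by (simp add: path_connectedin_topspace)
  show "cocycles 1 X \<subseteq> coboundaries 1 X"
  proof
    fix a assume a: "a \<in> cocycles 1 X"
    have "\<exists>h. potential_of (subtopology X U) h a \<and> h x0 = 0" if U: "U \<in> \<U>" for U
    proof (rule potential_of_vanishing_on_cycles[of "subtopology X U" x0 a])
      show "path_connected_space (subtopology X U)"
        using pcU[OF U] by (simp add: path_connectedin_def)
      show "x0 \<in> topspace (subtopology X U)"
        using x0 U by simp
      show "chain_eval a c = 0" if c: "singular_relcycle 1 (subtopology X U) {} c" for c
      proof (rule chain_eval_cocycle_boundary[OF a])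
        have "singular_relboundary 1 (subtopology X U) {} c"
          using contr[OF U] c by (intro contractible_cycle_boundary) simp_all
        then show "singular_relboundary 1 X {} c"
          using singular_boundary_mono[of U UNIV 1 X c] by simp
      qed
    qed blast
    then obtain H where H: "\<And>U. U \<in> \<U> \<Longrightarrow> potential_of (subtopology X U) (H U) a \<and> H U x0 = 0"
      by metis
    \<comment> \<open>Both potentials vanish at \<open>x0\<close>, so at \<open>x\<close> each
      equals the value of \<open>a\<close> on one and the same path inside the intersection.\<close>
    have agree: "H U x = H V x" if UV: "U \<in> \<U>" "V \<in> \<U>" "x \<in> U" "x \<in> V" for U V x
    proof -
      have "path_connected_space (subtopology X (U \<inter> V))"
        using inter[OF UV(1,2)] by (simp add: path_connectedin_def)
      moreover have "x0 \<in> topspace (subtopology X (U \<inter> V))" "x \<in> topspace (subtopology X (U \<inter> V))"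
        using x0(1)[OF UV(1)] x0(1)[OF UV(2)] x0(2) UV(3,4) sub[OF UV(1)] by auto
      ultimately obtain \<gamma> where \<gamma>: "pathin (subtopology X (U \<inter> V)) \<gamma>" "\<gamma> 0 = x0" "\<gamma> 1 = x"
        unfolding path_connected_space_def by metis
      have "H W x = a (path_simplex \<gamma>)" if W: "W \<in> \<U>" "U \<inter> V \<subseteq> W" for W
      proof -
        have "singular_simplex 1 (subtopology X W) (path_simplex \<gamma>)"
          using singular_simplex_path_simplex[OF \<gamma>(1)] W(2) by (rule singular_simplex_mono)
        then have "a (path_simplex \<gamma>) = H W (\<gamma> 1) + H W (\<gamma> 0)"
          using H[OF W(1)] unfolding potential_of_def by (metis path_simplex_ends(1,2))
        then show ?thesis
          using H[OF W(1)] by (simp add: \<gamma>)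
      qed
      from this[OF UV(1)] this[OF UV(2)] show ?thesis
        by simp
    qed
    define h where "h x = H (SOME U. U \<in> \<U> \<and> x \<in> U) x" for x
    have h: "h x = H U x" if "U \<in> \<U>" "x \<in> U" for U x
      unfolding h_def by (rule agree) (use someI[of "\<lambda>U. U \<in> \<U> \<and> x \<in> U" U] that in auto)
    \<comment> \<open>The glued function is compared with \<open>a\<close> only on edges inside a
      single set of the cover; an edge crossing several sets is not yet under control.\<close>
    have small: "a \<sigma> = coboundary 0 X (point_cochain X h) \<sigma>"
      if U: "U \<in> \<U>" and \<sigma>: "singular_simplex 1 X \<sigma>" "\<sigma> \<in> standard_simplex 1 \<rightarrow> U" for \<sigma> U
    proof -
      have "singular_simplex 1 (subtopology X U) \<sigma>"
        using \<sigma> by (auto simp: singular_simplex_subtopology)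
      moreover have "\<sigma> (vertex 0) \<in> U" "\<sigma> (vertex 1) \<in> U"
        using \<sigma>(2) by (auto simp: Pi_iff)
      ultimately show ?thesis
        using H[OF U] unfolding potential_of_def coboundary_point_cochain[OF \<sigma>(1)]
        by (simp only: h[OF U])
    qed
    have "chain_eval a c = 0" if c: "singular_relcycle 1 X {} c" for c
    proof -
      \<comment> \<open>Subdivision replaces the cycle by a homologous one made of small edges. The
        value of \<open>a\<close> does not change, as a cocycle vanishes on boundaries.\<close>
      obtain c' where c': "singular_relcycle 1 X {} c'" "homologous_rel 1 X {} c c'"
          "\<And>\<sigma>. \<sigma> \<in> Poly_Mapping.keys c' \<Longrightarrow> \<exists>V\<in>\<U>. \<sigma> \<in> standard_simplex 1 \<rightarrow> V"
        using small_homologous_rel_relcycle_exists[OF op cover c] by blast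
      have ch: "singular_chain 1 X c'" and bd: "chain_boundary 1 c' = 0"
        using c'(1) by (simp_all add: singular_cycle)
      have "chain_eval a c + chain_eval a c' = chain_eval a (c - c')"
        by (simp add: chain_eval_diff)
      also have "\<dots> = 0"
        using c'(2) by (intro chain_eval_cocycle_boundary[OF a]) (simp add: homologous_rel_def)
      finally have "chain_eval a c = chain_eval a c'"
        by (simp only: bit_add_eq_0_iff)
      also have "\<dots> = chain_eval (coboundary 0 X (point_cochain X h)) c'"
      proof (rule chain_eval_cong)
        fix \<sigma> assume \<sigma>: "\<sigma> \<in> Poly_Mapping.keys c'"
        then have "singular_simplex 1 X \<sigma>"
          using ch unfolding singular_chain_def by blast
        then show "a \<sigma> = coboundary 0 X (point_cochain X h) \<sigma>"
          using c'(3)[OF \<sigma>] small by blast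
      qed
      also have "\<dots> = chain_eval (point_cochain X h) (chain_boundary 1 c')"
        using ch chain_eval_boundary[of 0 X c' "point_cochain X h"] by simp
      finally show ?thesis
        using bd by simp
    qed
    \<comment> \<open>Vanishing on all cycles now gives a potential valid on every edge of
      \<open>X\<close>, small or not.\<close>
    then obtain g where "potential_of X g a"
      using potential_of_vanishing_on_cycles[OF pc x0(2)] by metis
    then show "a \<in> coboundaries 1 X"
      using a by (intro potential_coboundaries_1) (simp_all add: cocycles_def)
  qed
qed

section \<open>Charts of Milnor manifolds\<close>

lemma continuous_map_times:
  fixes f g :: "'a \<Rightarrow> 'b::real_normed_algebra"
  assumes "continuous_map X euclidean f" "continuous_map X euclidean g"
  shows "continuous_map X euclidean (\<lambda>x. f x * g x)"
  using assms unfolding continuous_map_atin limitin_canonical_iff by (auto intro: tendsto_mult)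

lemma continuous_map_quotient:
  fixes f g :: "'a \<Rightarrow> 'b::real_normed_field"
  assumes "continuous_map X euclidean f" "continuous_map X euclidean g"
    and "\<And>x. x \<in> topspace X \<Longrightarrow> g x \<noteq> 0"
  shows "continuous_map X euclidean (\<lambda>x. f x / g x)"
  using assms unfolding continuous_map_atin limitin_canonical_iff by (auto intro: tendsto_divide)

section \<open>Affine charts of complex projective space\<close>

lemma topspace_punctured_space:
  "z \<in> topspace (punctured_space r) \<longleftrightarrow> z \<in> extensional {..r} \<and> (\<exists>k\<le>r. z k \<noteq> 0)"
  by (auto simp: punctured_space_def PiE_def fun_eq_iff extensional_def restrict_def)

lemma continuous_map_punctured_space:
  assumes "\<And>k. k \<le> r \<Longrightarrow> continuous_map Y euclidean (\<lambda>y. f y k)"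
    and "\<And>y. y \<in> topspace Y \<Longrightarrow> \<exists>k\<le>r. f y k \<noteq> 0"
  shows "continuous_map Y (punctured_space r) (\<lambda>y. \<lambda>k\<in>{..r}. f y k)"
proof -
  have "continuous_map Y (product_topology (\<lambda>i. euclidean) {..r}) (\<lambda>y. \<lambda>k\<in>{..r}. f y k)"
    unfolding continuous_map_componentwise using assms(1) by auto
  moreover have "(\<lambda>k\<in>{..r}. f y k) \<noteq> (\<lambda>k\<in>{..r}. 0)" if "y \<in> topspace Y" for y
    using assms(2)[OF that] by (auto simp: fun_eq_iff)
  ultimately show ?thesis
    unfolding punctured_space_def continuous_map_in_subtopology by auto
qed

lemma continuous_map_punctured_coordinate:
  assumes "k \<le> r"
  shows "continuous_map (punctured_space r) euclidean (\<lambda>z. z k)"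
  unfolding punctured_space_def
  by (intro continuous_map_from_subtopology continuous_map_product_projection) (use assms in auto)

text \<open>A ratio of two homogeneous coordinates is the same for all representatives of a line, so
  an arbitrary one may be chosen.\<close>

definition affine_coord :: "nat \<Rightarrow> (nat \<Rightarrow> complex) set \<Rightarrow> nat \<Rightarrow> complex" where
  "affine_coord i A k = (SOME z. z \<in> A) k / (SOME z. z \<in> A) i"

lemma affine_coord_homogeneous:
  assumes "i \<le> r" "k \<le> r"
  shows "affine_coord i (homogeneous r z) k = z k / z i"
proof -
  have "(\<lambda>j\<in>{..r}. 1 * z j) \<in> homogeneous r z"
    unfolding homogeneous_def using one_neq_zero by blast
  then have "(SOME y. y \<in> homogeneous r z) \<in> homogeneous r z"
    using some_in_eq by blast
  then obtain c where "c \<noteq> 0" "(SOME y. y \<in> homogeneous r z) = (\<lambda>j\<in>{..r}. c * z j)"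
    unfolding homogeneous_def by auto
  then show ?thesis
    using assms by (simp add: affine_coord_def)
qed

text \<open>Where \<open>z\<^sub>i = 0\<close>, the \<open>i\<close>-th affine coordinate is \<open>0 / 0 = 0\<close> instead of \<open>1\<close>.\<close>

definition affine_chart :: "nat \<Rightarrow> nat \<Rightarrow> (nat \<Rightarrow> complex) set set" where
  "affine_chart r i = {A \<in> topspace (complex_projective_space r). affine_coord i A i \<noteq> 0}"

lemma topspace_complex_projective_space:
  "topspace (complex_projective_space r) = homogeneous r ` topspace (punctured_space r)"
  by (simp add: complex_projective_space_def topspace_quotient_topology)

lemma openin_punctured_quotient:
  assumes "i \<le> r" "k \<le> r" "open V"
  shows "openin (punctured_space r) {z \<in> topspace (punctured_space r). z i \<noteq> 0 \<and> z k / z i \<in> V}"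
proof -
  define S where "S = {z \<in> topspace (punctured_space r). z i \<in> - {0}}"
  have S: "openin (punctured_space r) S"
    unfolding S_def
    by (rule openin_continuous_map_preimage[OF continuous_map_punctured_coordinate]) (use assms in auto)
  have "continuous_map (subtopology (punctured_space r) S) euclidean (\<lambda>z. z k / z i)"
    by (intro continuous_map_quotient continuous_map_from_subtopology
        continuous_map_punctured_coordinate) (use assms in \<open>auto simp: S_def\<close>)
  then have "openin (subtopology (punctured_space r) S)
      {z \<in> topspace (subtopology (punctured_space r) S). z k / z i \<in> V}"
    by (rule openin_continuous_map_preimage) (use assms in auto)
  then have "openin (punctured_space r)
      {z \<in> topspace (subtopology (punctured_space r) S). z k / z i \<in> V}"
    by (rule openin_trans_full[OF _ S])
  moreover have "{z \<in> topspace (subtopology (punctured_space r) S). z k / z i \<in> V} =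
      {z \<in> topspace (punctured_space r). z i \<noteq> 0 \<and> z k / z i \<in> V}"
    by (auto simp: S_def)
  ultimately show ?thesis by simp
qed

text \<open>Openness in the quotient topology is openness of the preimage in
  \<open>punctured_space r\<close>, where the coordinate is an honest quotient of continuous
  functions.\<close>

lemma openin_affine_coord_preimage:
  assumes "i \<le> r" "k \<le> r" "open V"
  shows "openin (complex_projective_space r) {A \<in> affine_chart r i. affine_coord i A k \<in> V}"
proof -
  have "{z \<in> topspace (punctured_space r).
        homogeneous r z \<in> {A \<in> affine_chart r i. affine_coord i A k \<in> V}} =
      {z \<in> topspace (punctured_space r). z i \<noteq> 0 \<and> z k / z i \<in> V}"
    using assms
    by (auto simp: affine_chart_def affine_coord_homogeneous topspace_complex_projective_space)
  then show ?thesis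
    using openin_punctured_quotient[OF assms]
    unfolding complex_projective_space_def openin_quotient_topology
    by (auto simp: affine_chart_def complex_projective_space_def topspace_quotient_topology)
qed

lemma openin_affine_chart: "i \<le> r \<Longrightarrow> openin (complex_projective_space r) (affine_chart r i)"
  using openin_affine_coord_preimage[of i r i UNIV] by simp

lemma continuous_map_affine_coord:
  assumes "i \<le> r" "k \<le> r"
  shows "continuous_map (subtopology (complex_projective_space r) (affine_chart r i)) euclidean
     (\<lambda>A. affine_coord i A k)"
proof -
  have "{A \<in> topspace (subtopology (complex_projective_space r) (affine_chart r i)).
      affine_coord i A k \<in> V} = {A \<in> affine_chart r i. affine_coord i A k \<in> V}" for V
    by (auto simp: affine_chart_def)
  then show ?thesis
    using openin_affine_coord_preimage[OF assms] openin_affine_chart[OF assms(1)]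
    by (auto simp: continuous_map_def openin_open_subtopology)
qed

section \<open>Points of the Milnor manifold in homogeneous coordinates\<close>

definition milnor_point ::
    "nat \<Rightarrow> nat \<Rightarrow> (nat \<Rightarrow> complex) \<Rightarrow> (nat \<Rightarrow> complex) \<Rightarrow>
      (nat \<Rightarrow> complex) set \<times> (nat \<Rightarrow> complex) set" where
  "milnor_point r s z w = (homogeneous r (\<lambda>k\<in>{..r}. z k), homogeneous s (\<lambda>k\<in>{..s}. w k))"

definition milnor_coords :: "nat \<Rightarrow> nat \<Rightarrow> (nat \<Rightarrow> complex) \<Rightarrow> (nat \<Rightarrow> complex) \<Rightarrow> bool" where
  "milnor_coords r s z w \<longleftrightarrow>
     (\<exists>k\<le>r. z k \<noteq> 0) \<and> (\<exists>k\<le>s. w k \<noteq> 0) \<and> (\<Sum>k\<le>s. z k * cnj (w k)) = 0"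

lemma restrict_in_punctured_space:
  "(\<lambda>k\<in>{..r}. z k) \<in> topspace (punctured_space r) \<longleftrightarrow> (\<exists>k\<le>r. z k \<noteq> 0)"
  by (auto simp: topspace_punctured_space)

text \<open>Since \<open>milnor_point\<close> truncates its arguments, \<open>z\<close> and
  \<open>w\<close> may be arbitrary total functions; formulas for homotopies and paths can then be
  written coordinate by coordinate.\<close>

lemma topspace_milnor_manifold:
  assumes "s \<le> r"
  shows "topspace (milnor_manifold r s) = {milnor_point r s z w | z w. milnor_coords r s z w}"
proof (intro equalityI subsetI)
  fix p assume "p \<in> topspace (milnor_manifold r s)"
  then obtain z w where p: "p = (homogeneous r z, homogeneous s w)"
    and zw: "z \<in> topspace (punctured_space r)" "w \<in> topspace (punctured_space s)"
      "(\<Sum>i\<le>s. z i * cnj (w i)) = 0"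
    by (auto simp: milnor_manifold_def)
  moreover have "p = milnor_point r s z w"
    using zw unfolding milnor_point_def p by (simp add: topspace_punctured_space extensional_restrict)
  moreover have "milnor_coords r s z w"
    using zw by (simp add: milnor_coords_def topspace_punctured_space)
  ultimately show "p \<in> {milnor_point r s z w | z w. milnor_coords r s z w}"
    by blast
next
  fix p assume "p \<in> {milnor_point r s z w | z w. milnor_coords r s z w}"
  then obtain z w where p: "p = milnor_point r s z w" and zw: "milnor_coords r s z w"
    by blast
  let ?z = "\<lambda>k\<in>{..r}. z k" and ?w = "\<lambda>k\<in>{..s}. w k"
  have "(\<Sum>k\<le>s. ?z k * cnj (?w k)) = (\<Sum>k\<le>s. z k * cnj (w k))"
    by (rule sum.cong) (use assms in auto)
  then have "?z \<in> topspace (punctured_space r)" "?w \<in> topspace (punctured_space s)"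
    "(\<Sum>k\<le>s. ?z k * cnj (?w k)) = 0"
    using zw unfolding restrict_in_punctured_space milnor_coords_def by auto
  then show "p \<in> topspace (milnor_manifold r s)"
    unfolding p milnor_point_def milnor_manifold_def
    by (auto simp: topspace_complex_projective_space simp del: restrict_apply)
qed

lemma milnor_point_in_manifold:
  "s \<le> r \<Longrightarrow> milnor_coords r s z w \<Longrightarrow> milnor_point r s z w \<in> topspace (milnor_manifold r s)"
  by (auto simp: topspace_milnor_manifold)

lemma homogeneous_scale:
  assumes "c \<noteq> 0"
  shows "homogeneous r (\<lambda>k\<in>{..r}. c * z k) = homogeneous r (\<lambda>k\<in>{..r}. z k)"
proof -
  have sub: "homogeneous r (\<lambda>k\<in>{..r}. c * z k) \<subseteq> homogeneous r (\<lambda>k\<in>{..r}. z k)"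
    if "c \<noteq> 0" for c z
  proof
    fix x assume "x \<in> homogeneous r (\<lambda>k\<in>{..r}. c * z k)"
    then obtain d where d: "d \<noteq> 0" "x = (\<lambda>k\<in>{..r}. d * (\<lambda>k\<in>{..r}. c * z k) k)"
      unfolding homogeneous_def by blast
    then have "x = (\<lambda>k\<in>{..r}. (d * c) * (\<lambda>k\<in>{..r}. z k) k)"
      by (auto simp: fun_eq_iff)
    moreover have "d * c \<noteq> 0"
      using d(1) that by simp
    ultimately show "x \<in> homogeneous r (\<lambda>k\<in>{..r}. z k)"
      unfolding homogeneous_def by blast
  qed
  have "(\<lambda>k\<in>{..r}. (1 / c) * (c * z k)) = (\<lambda>k\<in>{..r}. z k)"
    using assms by (auto simp: fun_eq_iff)
  then show ?thesis
    using sub[of c z] sub[of "1 / c" "\<lambda>k. c * z k"] assms by auto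
qed

lemma milnor_point_cong:
  assumes "\<And>k. k \<le> r \<Longrightarrow> z k = z' k" "\<And>k. k \<le> s \<Longrightarrow> w k = w' k"
  shows "milnor_point r s z w = milnor_point r s z' w'"
proof -
  have "(\<lambda>k\<in>{..r}. z k) = (\<lambda>k\<in>{..r}. z' k)" "(\<lambda>k\<in>{..s}. w k) = (\<lambda>k\<in>{..s}. w' k)"
    using assms by (auto simp: fun_eq_iff)
  then show ?thesis
    by (simp only: milnor_point_def)
qed

lemma milnor_point_scale:
  assumes "c \<noteq> 0" "d \<noteq> 0"
  shows "milnor_point r s (\<lambda>k. z k / c) (\<lambda>k. w k / d) = milnor_point r s z w"
  using homogeneous_scale[of "1 / c" r z] homogeneous_scale[of "1 / d" s w] assms
  by (simp add: milnor_point_def)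

text \<open>The contractions of charts and the paths in their intersections get their continuity
  from here: coordinates are continuous into the punctured spaces, and the projections to projective
  space are quotient maps.\<close>

lemma continuous_map_milnor_point:
  assumes "s \<le> r"
    and "\<And>k. k \<le> r \<Longrightarrow> continuous_map Y euclidean (\<lambda>y. z y k)"
    and "\<And>k. k \<le> s \<Longrightarrow> continuous_map Y euclidean (\<lambda>y. w y k)"
    and valid: "\<And>y. y \<in> topspace Y \<Longrightarrow> milnor_coords r s (z y) (w y)"
  shows "continuous_map Y (milnor_manifold r s) (\<lambda>y. milnor_point r s (z y) (w y))"
proof -
  have hom: "continuous_map (punctured_space n) (complex_projective_space n) (homogeneous n)" for n
    unfolding complex_projective_space_def
    by (rule quotient_imp_continuous_map[OF quotient_map_quotient_topology])
  have "continuous_map Y (punctured_space r) (\<lambda>y. \<lambda>k\<in>{..r}. z y k)"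
    "continuous_map Y (punctured_space s) (\<lambda>y. \<lambda>k\<in>{..s}. w y k)"
    by (rule continuous_map_punctured_space; use assms in \<open>auto simp: milnor_coords_def\<close>)+
  from this[THEN continuous_map_compose, OF hom] this[THEN continuous_map_compose, OF hom]
  have "continuous_map Y (prod_topology (complex_projective_space r) (complex_projective_space s))
      (\<lambda>y. milnor_point r s (z y) (w y))"
    by (simp add: milnor_point_def continuous_map_pairwise o_def)
  moreover have "milnor_point r s (z y) (w y) \<in> topspace (milnor_manifold r s)" if "y \<in> topspace Y" for y
    using milnor_point_in_manifold[OF assms(1) valid[OF that]] .
  ultimately show ?thesis
    unfolding milnor_manifold_def continuous_map_in_subtopology by auto
qed

section \<open>Charts of the Milnor manifold, their contractions and their intersections\<close>

definition milnor_chart ::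
    "nat \<Rightarrow> nat \<Rightarrow> nat \<Rightarrow> nat \<Rightarrow> ((nat \<Rightarrow> complex) set \<times> (nat \<Rightarrow> complex) set) set" where
  "milnor_chart r s i j = topspace (milnor_manifold r s) \<inter> affine_chart r i \<times> affine_chart s j"

lemma openin_milnor_chart:
  assumes "i \<le> r" "j \<le> s"
  shows "openin (milnor_manifold r s) (milnor_chart r s i j)"
proof -
  let ?P = "prod_topology (complex_projective_space r) (complex_projective_space s)"
  let ?D = "affine_chart r i \<times> affine_chart s j"
  have op: "openin ?P ?D"
    using assms by (simp add: openin_prod_Times_iff openin_affine_chart)
  obtain E where E: "milnor_manifold r s = subtopology ?P E"
    unfolding milnor_manifold_def by blast
  have "topspace ?P \<inter> E \<inter> ?D = ?D \<inter> E"
    using openin_subset[OF op] by blast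
  then show ?thesis
    using openin_subtopology_Int[OF op, of E] unfolding milnor_chart_def E topspace_subtopology by simp
qed

lemma milnor_point_in_chart:
  assumes "s \<le> r" "i \<le> r" "j \<le> s" "milnor_coords r s z w"
  shows "milnor_point r s z w \<in> milnor_chart r s i j \<longleftrightarrow> z i \<noteq> 0 \<and> w j \<noteq> 0"
proof -
  have "milnor_point r s z w \<in> topspace (milnor_manifold r s)"
    using milnor_point_in_manifold assms by blast
  moreover have "topspace (milnor_manifold r s) \<subseteq>
      topspace (complex_projective_space r) \<times> topspace (complex_projective_space s)"
    by (auto simp: milnor_manifold_def)
  ultimately show ?thesis
    using assms by (auto simp: milnor_chart_def affine_chart_def milnor_point_def affine_coord_homogeneous)
qed

text \<open>Normalising multiplies the defining sum by a single nonzero factor, so the affine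
  coordinates are again homogeneous coordinates of the point that satisfy the equation.\<close>

lemma milnor_chart_coords:
  assumes "s \<le> r" "i \<le> r" "j \<le> s" "p \<in> milnor_chart r s i j"
  defines "z \<equiv> affine_coord i (fst p)" and "w \<equiv> affine_coord j (snd p)"
  shows "p = milnor_point r s z w" "milnor_coords r s z w" "z i = 1" "w j = 1"
proof -
  obtain x y where p: "p = milnor_point r s x y" and xy: "milnor_coords r s x y"
    using assms topspace_milnor_manifold[of s r] by (auto simp: milnor_chart_def)
  have nz: "x i \<noteq> 0" "y j \<noteq> 0"
    using milnor_point_in_chart[OF assms(1-3) xy] assms(4) p by auto
  have z: "z k = x k / x i" if "k \<le> r" for k
    using that assms by (simp add: z_def p milnor_point_def affine_coord_homogeneous)
  have w: "w k = y k / y j" if "k \<le> s" for k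
    using that assms by (simp add: w_def p milnor_point_def affine_coord_homogeneous)
  show "p = milnor_point r s z w"
    unfolding p milnor_point_scale[OF nz, of r s x y, symmetric] by (rule milnor_point_cong) (auto simp: z w)
  have "(\<Sum>k\<le>s. z k * cnj (w k)) = (\<Sum>k\<le>s. x k * cnj (y k) / (x i * cnj (y j)))"
    by (rule sum.cong) (use assms z w in auto)
  also have "\<dots> = (\<Sum>k\<le>s. x k * cnj (y k)) / (x i * cnj (y j))"
    by (rule sum_divide_distrib[symmetric])
  also have "\<dots> = 0"
    using xy by (simp add: milnor_coords_def)
  finally have "(\<Sum>k\<le>s. z k * cnj (w k)) = 0" .
  moreover show "z i = 1" "w j = 1"
    using z w nz assms by auto
  ultimately show "milnor_coords r s z w"
    unfolding milnor_coords_def using assms by (metis one_neq_zero)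
qed

lemma continuous_map_milnor_coords:
  assumes "i \<le> r" "j \<le> s"
  shows "k \<le> r \<Longrightarrow> continuous_map (subtopology (milnor_manifold r s) (milnor_chart r s i j)) euclidean
      (\<lambda>p. affine_coord i (fst p) k)"
    and "k \<le> s \<Longrightarrow> continuous_map (subtopology (milnor_manifold r s) (milnor_chart r s i j)) euclidean
      (\<lambda>p. affine_coord j (snd p) k)"
proof -
  let ?U = "subtopology (milnor_manifold r s) (milnor_chart r s i j)"
  have "continuous_map ?U (subtopology (complex_projective_space r) (affine_chart r i)) fst"
    unfolding continuous_map_in_subtopology milnor_manifold_def
    by (auto intro!: continuous_map_from_subtopology continuous_map_fst simp: milnor_chart_def)
  from continuous_map_compose[OF this continuous_map_affine_coord]
  show "k \<le> r \<Longrightarrow> continuous_map ?U euclidean (\<lambda>p. affine_coord i (fst p) k)"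
    using assms by (simp add: o_def)
  have "continuous_map ?U (subtopology (complex_projective_space s) (affine_chart s j)) snd"
    unfolding continuous_map_in_subtopology milnor_manifold_def
    by (auto intro!: continuous_map_from_subtopology continuous_map_snd simp: milnor_chart_def)
  from continuous_map_compose[OF this continuous_map_affine_coord]
  show "k \<le> s \<Longrightarrow> continuous_map ?U euclidean (\<lambda>p. affine_coord j (snd p) k)"
    using assms by (simp add: o_def)
qed

text \<open>
  The weights of \<open>z\<^sub>k\<close> and \<open>w\<^sub>k\<close> add up to \<open>2\<close> for every \<open>k\<close>, so scaling preserves the equation; as
  \<open>z\<^sub>i\<close> and \<open>w\<^sub>j\<close> are the only coordinates of weight \<open>0\<close>, it contracts the chart to the point
  \<open>(e\<^sub>i, e\<^sub>j)\<close>.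
\<close>

lemma contractible_milnor_chart:
  assumes "s \<le> r" "i \<le> r" "j \<le> s" "i \<noteq> j"
  shows "contractible_space (subtopology (milnor_manifold r s) (milnor_chart r s i j))"
proof -
  let ?U = "subtopology (milnor_manifold r s) (milnor_chart r s i j)"
  define m where "m k = (if k = i then 0 else if k = j then 2 else 1::nat)" for k
  have m2: "m k \<le> 2" for k by (simp add: m_def)
  \<comment> \<open>The factor is real, hence fixed by conjugation, and runs from 1 to 0. At the end
    \<open>0 ^ 0 = 1\<close> preserves exactly the coordinates of weight 0.\<close>
  define c where "c u = complex_of_real (1 - fst u)" for u :: "real \<times> (nat \<Rightarrow> complex) set \<times> (nat \<Rightarrow> complex) set"
  define Z :: "_ \<Rightarrow> nat \<Rightarrow> complex" where "Z u k = c u ^ m k * affine_coord i (fst (snd u)) k" for u k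
  define W :: "_ \<Rightarrow> nat \<Rightarrow> complex" where "W u k = c u ^ (2 - m k) * affine_coord j (snd (snd u)) k" for u k
  let ?I = "prod_topology (top_of_set {0..1::real}) ?U"
  have topU: "topspace ?U = milnor_chart r s i j"
    by (auto simp: milnor_chart_def)
  have mem: "snd u \<in> milnor_chart r s i j" if "u \<in> topspace ?I" for u
    using that unfolding topspace_prod_topology topU mem_Times_iff by blast
  have snd: "continuous_map ?I ?U snd"
    by (rule continuous_map_snd)
  have "continuous_map ?I (top_of_set {0..1}) fst"
    by (rule continuous_map_fst)
  then have "continuous_map ?I euclidean fst"
    by (simp add: continuous_map_in_subtopology)
  then have pow: "continuous_map ?I euclidean (\<lambda>u. c u ^ n)" for n
    unfolding continuous_map_atin limitin_canonical_iff c_def by (auto intro!: tendsto_intros)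
  have valid: "milnor_coords r s (Z u) (W u) \<and> Z u i = 1 \<and> W u j = 1"
    if "snd u \<in> milnor_chart r s i j" for u
  proof -
    note crd = milnor_chart_coords[OF assms(1-3) that]
    have one: "Z u i = 1" "W u j = 1"
      using crd assms(4) by (simp_all add: Z_def W_def m_def)
    have "Z u k * cnj (W u k) = (c u)\<^sup>2 * (affine_coord i (fst (snd u)) k * cnj (affine_coord j (snd (snd u)) k))" for k
    proof -
      have "c u ^ m k * c u ^ (2 - m k) = (c u)\<^sup>2"
        using m2[of k] by (simp flip: power_add)
      moreover have "cnj (c u ^ n) = c u ^ n" for n
        by (simp add: c_def)
      ultimately have "(c u)\<^sup>2 = c u ^ m k * cnj (c u ^ (2 - m k))"
        by simp
      then show ?thesis
        unfolding Z_def W_def by (simp only: complex_cnj_mult mult_ac)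
    qed
    then have "(\<Sum>k\<le>s. Z u k * cnj (W u k)) =
        (c u)\<^sup>2 * (\<Sum>k\<le>s. affine_coord i (fst (snd u)) k * cnj (affine_coord j (snd (snd u)) k))"
      by (simp add: sum_distrib_left)
    also have "\<dots> = 0"
      using crd(2) by (simp add: milnor_coords_def)
    finally show ?thesis
      using one assms unfolding milnor_coords_def by (metis one_neq_zero)
  qed
  have "continuous_map ?I (milnor_manifold r s) (\<lambda>u. milnor_point r s (Z u) (W u))"
  proof (rule continuous_map_milnor_point[OF assms(1)])
    show "continuous_map ?I euclidean (\<lambda>u. Z u k)" if "k \<le> r" for k
      unfolding Z_def
      using continuous_map_compose[OF snd continuous_map_milnor_coords(1)[OF assms(2,3) that]]
      by (intro continuous_map_times pow) (simp add: o_def)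
    show "continuous_map ?I euclidean (\<lambda>u. W u k)" if "k \<le> s" for k
      unfolding W_def
      using continuous_map_compose[OF snd continuous_map_milnor_coords(2)[OF assms(2,3) that]]
      by (intro continuous_map_times pow) (simp add: o_def)
    show "milnor_coords r s (Z u) (W u)" if "u \<in> topspace ?I" for u
      using valid[OF mem[OF that]] by blast
  qed
  moreover have "milnor_point r s (Z u) (W u) \<in> milnor_chart r s i j" if "u \<in> topspace ?I" for u
    using valid[OF mem[OF that]] milnor_point_in_chart[OF assms(1-3), of "Z u" "W u"] by simp
  ultimately have "continuous_map ?I ?U (\<lambda>u. milnor_point r s (Z u) (W u))"
    unfolding continuous_map_in_subtopology by blast
  moreover have "milnor_point r s (Z (0, p)) (W (0, p)) = p" if "p \<in> topspace ?U" for p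
  proof -
    have "Z (0, p) = affine_coord i (fst p)" "W (0, p) = affine_coord j (snd p)"
      by (simp_all add: Z_def W_def c_def fun_eq_iff)
    then show ?thesis
      using milnor_chart_coords(1)[OF assms(1-3), of p] that topU by metis
  qed
  moreover have "milnor_point r s (Z (1, p)) (W (1, p)) =
      milnor_point r s (\<lambda>k. if k = i then 1 else 0) (\<lambda>k. if k = j then 1 else 0)"
    if "p \<in> topspace ?U" for p
    using milnor_chart_coords(3,4)[OF assms(1-3), of p] that topU assms(4)
    by (intro milnor_point_cong) (auto simp: Z_def W_def c_def m_def)
  ultimately have "homotopic_with (\<lambda>x. True) ?U ?U id
      (\<lambda>x. milnor_point r s (\<lambda>k. if k = i then 1 else 0) (\<lambda>k. if k = j then 1 else 0))"
    by (subst homotopic_with) (auto intro!: exI[of _ "\<lambda>u. milnor_point r s (Z u) (W u)"])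
  then show ?thesis
    unfolding contractible_space_def by blast
qed

text \<open>
  Chart coordinates are affine except for \<open>z\<^sub>j\<close>, which the equation determines. On the complex line
  through two points, the coordinates that must not vanish are nonzero polynomials (in the
  conjugates of \<open>w\<close>), so only finitely many parameters have to be avoided.
\<close>

lemma path_connectedin_milnor_chart_Int:
  assumes "s \<le> r" "i \<le> r" "j \<le> s" "i \<noteq> j" "k \<le> r" "l \<le> s"
  shows "path_connectedin (milnor_manifold r s) (milnor_chart r s i j \<inter> milnor_chart r s k l)"
proof -
  let ?C = "milnor_chart r s i j \<inter> milnor_chart r s k l"
  have "\<exists>g. pathin (milnor_manifold r s) g \<and> g \<in> {0..1} \<rightarrow> ?C \<and> g 0 = p \<and> g 1 = p'"
    if p: "p \<in> ?C" and p': "p' \<in> ?C" for p p'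
  proof -
    define z w where "z = affine_coord i (fst p)" and "w = affine_coord j (snd p)"
    define z' w' where "z' = affine_coord i (fst p')" and "w' = affine_coord j (snd p')"
    have c: "p = milnor_point r s z w" "milnor_coords r s z w" "z i = 1" "w j = 1"
      unfolding z_def w_def using milnor_chart_coords[OF assms(1-3), of p] p by auto
    have c': "p' = milnor_point r s z' w'" "milnor_coords r s z' w'" "z' i = 1" "w' j = 1"
      unfolding z'_def w'_def using milnor_chart_coords[OF assms(1-3), of p'] p' by auto
    have nz: "z k \<noteq> 0" "w l \<noteq> 0"
      using milnor_point_in_chart[OF assms(1,5,6) c(2)] p c(1) by auto
    \<comment> \<open>Interpolating the conjugates of \<open>w\<close> makes the equation bilinear
      in \<open>Z\<close> and \<open>W\<close>, with polynomials in a complex parameter as entries.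
      As \<open>W j\<close> is the constant 1, the entry \<open>Z j\<close> can be chosen so that
      the equation holds for every parameter.\<close>
    define W where "W m = [:cnj (w m), cnj (w' m - w m):]" for m
    define L where "L m = [:z m, z' m - z m:]" for m
    define Z where "Z m = (if m = j then - (\<Sum>n\<in>{..s} - {j}. L n * W n) else L m)" for m
    have eq: "y j = - (\<Sum>n\<in>{..s} - {j}. y n * cnj (x n))" if "milnor_coords r s y x" "x j = 1" for x y
    proof -
      have "0 = (\<Sum>n\<le>s. y n * cnj (x n))"
        using that by (simp add: milnor_coords_def)
      also have "\<dots> = y j + (\<Sum>n\<in>{..s} - {j}. y n * cnj (x n))"
        using that assms by (subst sum.remove[of _ j]) auto
      finally show ?thesis
        by (simp add: eq_neg_iff_add_eq_0)
    qed
    have poly_W: "poly (W m) 0 = cnj (w m)" "poly (W m) 1 = cnj (w' m)" for m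
      by (simp_all add: W_def)
    have poly_L: "poly (L m) 0 = z m" "poly (L m) 1 = z' m" for m
      by (simp_all add: L_def)
    \<comment> \<open>Both given points satisfy the equation with j-th coordinate of
      \<open>w\<close> equal to 1, so the solved entry takes the right values at the ends.\<close>
    have poly_Z: "poly (Z m) 0 = z m" "poly (Z m) 1 = z' m" for m
      using eq[OF c(2,4)] eq[OF c'(2,4)] by (auto simp: Z_def poly_sum poly_W poly_L)
    have one: "poly (Z i) x = 1" "poly (W j) x = 1" for x
      using assms c c' by (simp_all add: Z_def L_def W_def)
    have sum0: "(\<Sum>n\<le>s. poly (Z n) x * poly (W n) x) = 0" for x
    proof -
      have "(\<Sum>n\<le>s. poly (Z n) x * poly (W n) x) =
          poly (Z j) x + (\<Sum>n\<in>{..s} - {j}. poly (Z n) x * poly (W n) x)"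
        using assms one by (subst sum.remove[of _ j]) auto
      also have "poly (Z j) x = - (\<Sum>n\<in>{..s} - {j}. poly (Z n) x * poly (W n) x)"
        by (simp add: Z_def poly_sum)
      finally show ?thesis by simp
    qed
    have "Z k \<noteq> 0" "W l \<noteq> 0"
      using nz poly_Z(1)[of k] poly_W(1)[of l] by auto
    then have "finite {x. poly (Z k) x = 0}" "finite {x. poly (W l) x = 0}"
      by (auto intro: poly_roots_finite)
    \<comment> \<open>Here the parameter has to be complex: the plane stays path connected after
      finitely many points are removed, a real interval need not.\<close>
    then have "path_connected (- ({x. poly (Z k) x = 0} \<union> {x. poly (W l) x = 0}))"
      by (intro path_connected_complement_countable) (auto intro: countable_finite)
    moreover have "0 \<in> - ({x. poly (Z k) x = 0} \<union> {x. poly (W l) x = 0})"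
      using nz by (simp add: poly_Z poly_W)
    moreover have "1 \<in> - ({x. poly (Z k) x = 0} \<union> {x. poly (W l) x = 0})"
      using milnor_point_in_chart[OF assms(1,5,6) c'(2)] p' c'(1) by (auto simp: poly_Z poly_W)
    ultimately obtain g where g: "path g" "pathstart g = 0" "pathfinish g = 1"
      "path_image g \<subseteq> - ({x. poly (Z k) x = 0} \<union> {x. poly (W l) x = 0})"
      unfolding path_connected_def by blast
    define G where "G t = milnor_point r s (\<lambda>m. poly (Z m) (g t)) (\<lambda>m. cnj (poly (W m) (g t)))" for t
    have valid: "milnor_coords r s (\<lambda>m. poly (Z m) x) (\<lambda>m. cnj (poly (W m) x))" for x
      unfolding milnor_coords_def complex_cnj_cnj using sum0[of x] one[of x] assms
      by (metis complex_cnj_one one_neq_zero)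
    have cont: "continuous_on {0..1} g"
      using g(1) by (simp add: path_def)
    have "pathin (milnor_manifold r s) G"
      unfolding pathin_def G_def
      by (rule continuous_map_milnor_point[OF assms(1)])
        (auto intro!: continuous_intros cont valid)
    moreover have "G t \<in> ?C" if t: "t \<in> {0..1}" for t
    proof -
      have "g t \<in> path_image g"
        using t by (simp add: path_image_def)
      then have "poly (Z k) (g t) \<noteq> 0" "poly (W l) (g t) \<noteq> 0"
        using g(4) by auto
      then show ?thesis
        unfolding G_def using one[of "g t"] valid[of "g t"] assms
        by (simp add: milnor_point_in_chart)
    qed
    moreover have "G 0 = p" "G 1 = p'"
      using g c(1) c'(1) by (simp_all add: G_def pathstart_def pathfinish_def poly_Z poly_W)
    ultimately show ?thesis by blast
  qed
  moreover have "?C \<subseteq> topspace (milnor_manifold r s)"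
    by (auto simp: milnor_chart_def)
  ultimately show ?thesis
    unfolding path_connectedin by blast
qed

text \<open>If nonzero \<open>z i\<close> and \<open>w j\<close> always had equal indices, only one
  term of the defining sum would survive, and it would be nonzero.\<close>

lemma milnor_chart_cover:
  assumes "s \<le> r" "p \<in> topspace (milnor_manifold r s)"
  obtains i j where "i \<le> r" "j \<le> s" "i \<noteq> j" "p \<in> milnor_chart r s i j"
proof -
  obtain z w where p: "p = milnor_point r s z w" and zw: "milnor_coords r s z w"
    using assms by (auto simp: topspace_milnor_manifold)
  have "\<exists>i\<le>r. \<exists>j\<le>s. i \<noteq> j \<and> z i \<noteq> 0 \<and> w j \<noteq> 0"
  proof (rule ccontr)
    assume neg: "\<not> ?thesis"
    obtain i j where ij: "i \<le> r" "z i \<noteq> 0" "j \<le> s" "w j \<noteq> 0"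
      using zw by (auto simp: milnor_coords_def)
    then have "i = j" using neg by blast
    then have "z k = 0" if "k \<le> s" "k \<noteq> j" for k
      using neg ij that assms(1) by (meson le_trans)
    then have "(\<Sum>k\<le>s. z k * cnj (w k)) = z j * cnj (w j)"
      using ij by (subst sum.remove[of _ j]) auto
    then show False
      using zw ij \<open>i = j\<close> by (simp add: milnor_coords_def)
  qed
  then show thesis
    using that milnor_point_in_chart[OF assms(1) _ _ zw] p by metis
qed

theorem milnor_manifold_cohomology:
  assumes "1 \<le> s" "s \<le> r"
  shows "path_connected_space (milnor_manifold r s)"
    and "cocycles 1 (milnor_manifold r s) \<subseteq> coboundaries 1 (milnor_manifold r s)"
    and "topspace (milnor_manifold r s) \<noteq> {}"
proof -
  \<comment> \<open>With all coordinates of \<open>w\<close> equal to 1, the s entries before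
    position s contribute s to the sum and the entry -s cancels them. As s is positive, no
    coordinate is zero, so the point lies in every chart.\<close>
  define z0 :: "nat \<Rightarrow> complex" where "z0 k = (if k = s then - of_nat s else 1)" for k
  let ?x = "milnor_point r s z0 (\<lambda>k. 1)"
  have "{..s} - {s} = {..<s}" by auto
  then have "(\<Sum>k\<le>s. z0 k) = - of_nat s + (\<Sum>k<s. z0 k)"
    by (subst sum.remove[of _ s]) (auto simp: z0_def)
  also have "(\<Sum>k<s. z0 k) = of_nat s"
    by (simp add: z0_def)
  finally have "milnor_coords r s z0 (\<lambda>k. 1)"
    using assms by (auto simp: milnor_coords_def z0_def)
  then have x: "?x \<in> topspace (milnor_manifold r s)"
    and xU: "\<And>i j. i \<le> r \<Longrightarrow> j \<le> s \<Longrightarrow> ?x \<in> milnor_chart r s i j"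
    using milnor_point_in_manifold milnor_point_in_chart assms by (auto simp: z0_def)
  show "topspace (milnor_manifold r s) \<noteq> {}"
    using x by blast
  define \<U> where "\<U> = {milnor_chart r s i j | i j. i \<le> r \<and> j \<le> s \<and> i \<noteq> j}"
  have cover: "topspace (milnor_manifold r s) \<subseteq> \<Union>\<U>"
  proof
    fix p assume "p \<in> topspace (milnor_manifold r s)"
    from milnor_chart_cover[OF assms(2) this] show "p \<in> \<Union>\<U>"
      unfolding \<U>_def by (metis (mono_tags, lifting) UnionI mem_Collect_eq)
  qed
  have "openin (milnor_manifold r s) U" "?x \<in> U"
    "contractible_space (subtopology (milnor_manifold r s) U)" if "U \<in> \<U>" for U
    using that openin_milnor_chart xU contractible_milnor_chart[OF assms(2)] by (auto simp: \<U>_def)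
  moreover have "path_connectedin (milnor_manifold r s) (U \<inter> V)" if "U \<in> \<U>" "V \<in> \<U>" for U V
    using that path_connectedin_milnor_chart_Int[OF assms(2)] by (auto simp: \<U>_def)
  ultimately show "path_connected_space (milnor_manifold r s)"
    "cocycles 1 (milnor_manifold r s) \<subseteq> coboundaries 1 (milnor_manifold r s)"
    using contractible_cover_coboundaries_1[OF _ cover _ x] by blast+
qed

section \<open>Cohomology in degrees zero and one under isomorphism\<close>

lemma cohomology_class_eq_iff:
  "cohomology_class p X a = cohomology_class p X b \<longleftrightarrow> (\<lambda>\<sigma>. a \<sigma> + b \<sigma>) \<in> coboundaries p X"
proof
  assume "cohomology_class p X a = cohomology_class p X b"
  moreover have "a \<in> cohomology_class p X a"
    by (simp add: mem_cohomology_class coboundaries_zero)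
  ultimately show "(\<lambda>\<sigma>. a \<sigma> + b \<sigma>) \<in> coboundaries p X"
    by (simp flip: mem_cohomology_class)
qed (simp add: cohomology_class_eq flip: mem_cohomology_class)

text \<open>In degree 0 the only coboundary is zero.\<close>

lemma cohomology_class_0_eq_iff: "cohomology_class 0 X a = cohomology_class 0 X b \<longleftrightarrow> a = b"
  by (simp add: cohomology_class_eq_iff fun_eq_iff bit_add_eq_0_iff)

lemma cocycles_0_constant_on_paths:
  assumes "a \<in> cocycles 0 X" "pathin X \<gamma>"
  shows "a (point_simplex (\<gamma> 0)) = a (point_simplex (\<gamma> 1))"
proof -
  have \<sigma>: "singular_simplex 1 X (path_simplex \<gamma>)"
    using assms(2) by (rule singular_simplex_path_simplex)
  have "coboundary 0 X a (path_simplex \<gamma>) = 0"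
    using assms(1) by (simp add: cocycles_def)
  then show ?thesis
    unfolding coboundary_0[OF \<sigma>] path_simplex_ends bit_add_eq_0_iff by (rule sym)
qed

lemma point_cochain_cocycle:
  assumes "\<And>\<gamma>. pathin X \<gamma> \<Longrightarrow> h (\<gamma> 0) = h (\<gamma> 1)"
  shows "point_cochain X h \<in> cocycles 0 X"
proof -
  have "coboundary 0 X (point_cochain X h) \<sigma> = 0" for \<sigma>
  proof (cases "singular_simplex 1 X \<sigma>")
    case True
    have "h (\<sigma> (vertex 0)) = h (\<sigma> (vertex 1))"
      using assms[OF pathin_edge[OF True]] by (simp only: edge_point_ends)
    then show ?thesis
      by (simp add: coboundary_point_cochain[OF True])
  qed (simp add: coboundary_def)
  then show ?thesis
    by (simp add: cocycles_def point_cochain_in_carrier fun_eq_iff)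
qed

lemma cocycles_0_path_connected:
  assumes "path_connected_space X" "a \<in> cocycles 0 X"
  obtains "a = point_cochain X (\<lambda>x. 0)" | "a = point_cochain X (\<lambda>x. 1)"
proof -
  have c: "a (point_simplex x) = a (point_simplex y)" if xy: "x \<in> topspace X" "y \<in> topspace X" for x y
  proof -
    obtain \<gamma> where "pathin X \<gamma>" "\<gamma> 0 = x" "\<gamma> 1 = y"
      using assms(1) xy unfolding path_connected_space_def by blast
    with cocycles_0_constant_on_paths[OF assms(2)] show ?thesis by blast
  qed
  have zero: "a \<sigma> = 0" if "\<not> singular_simplex 0 X \<sigma>" for \<sigma>
    using assms(2) that by (simp add: cocycles_def carrier_cochain_group)
  have const: "a = point_cochain X (\<lambda>x. k)"
    if "\<And>x. x \<in> topspace X \<Longrightarrow> a (point_simplex x) = k" for k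
  proof
    fix \<sigma>
    show "a \<sigma> = point_cochain X (\<lambda>x. k) \<sigma>"
      using that zero
      by (auto simp: point_cochain_def singular_simplex_0_iff)
  qed
  show thesis
  proof (cases "\<exists>x\<in>topspace X. a (point_simplex x) = 1")
    case True
    then obtain y where y: "y \<in> topspace X" "a (point_simplex y) = 1"
      by blast
    have "a (point_simplex x) = 1" if "x \<in> topspace X" for x
      using c[OF that y(1)] y(2) by simp
    then show ?thesis
      using const[of 1] that(2) by blast
  next
    case False
    then have "a (point_simplex x) = 0" if "x \<in> topspace X" for x
      using that by (cases "a (point_simplex x)") auto
    then show ?thesis
      using const[of 0] that(1) by blast
  qed
qed

text \<open>A counting argument: \<open>Y\<close> has exactly two classes in degree 0. At least two
  classes make \<open>X\<close> non-empty, and at most two leave no room for a second path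
  component.\<close>

lemma mod2_cohomology_iso_connected:
  assumes iso: "X \<simeq>\<^sub>2 Y" and Y: "path_connected_space Y" "topspace Y \<noteq> {}"
  shows "topspace X \<noteq> {}" "path_connected_space X"
proof -
  obtain h where "h \<in> iso (cohomology_group 0 X) (cohomology_group 0 Y)"
    using iso unfolding mod2_cohomology_iso_def by blast
  then have bij: "bij_betw h (cohomology_class 0 X ` cocycles 0 X) (cohomology_class 0 Y ` cocycles 0 Y)"
    by (simp add: Group.iso_def carrier_cohomology_group)
  have two: "A = B \<or> A = C \<or> B = C"
    if "A \<in> cohomology_class 0 X ` cocycles 0 X" "B \<in> cohomology_class 0 X ` cocycles 0 X"
      "C \<in> cohomology_class 0 X ` cocycles 0 X" for A B C
  proof -
    have "B = cohomology_class 0 Y (point_cochain Y (\<lambda>x. 0)) \<or>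
        B = cohomology_class 0 Y (point_cochain Y (\<lambda>x. 1))"
      if "B \<in> cohomology_class 0 Y ` cocycles 0 Y" for B
      using that by (auto elim: cocycles_0_path_connected[OF Y(1)])
    from this[of "h A"] this[of "h B"] this[of "h C"] have "h A = h B \<or> h A = h C \<or> h B = h C"
      using that by (auto simp only: bij_betwE[OF bij, rule_format])
    then show ?thesis
      using that by (simp only: inj_on_eq_iff[OF bij_betw_imp_inj_on[OF bij]])
  qed
  have ne: "point_cochain Z h1 \<noteq> point_cochain Z h2" if "x \<in> topspace Z" "h1 x \<noteq> h2 x"
    for Z :: "'z topology" and h1 h2 x
    using that by (metis point_cochain_point)
  have "point_cochain Y (\<lambda>x. 0) \<in> cocycles 0 Y" "point_cochain Y (\<lambda>x. 1) \<in> cocycles 0 Y"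
    by (rule point_cochain_cocycle; simp)+
  moreover have "cohomology_class 0 Y (point_cochain Y (\<lambda>x. 0)) \<noteq> cohomology_class 0 Y (point_cochain Y (\<lambda>x. 1))"
  proof -
    obtain y where "y \<in> topspace Y"
      using Y(2) by blast
    then show ?thesis
      using ne[of y Y "\<lambda>x. 0" "\<lambda>x. 1"] by (simp add: cohomology_class_0_eq_iff)
  qed
  ultimately have "cohomology_class 0 Y ` cocycles 0 Y \<noteq> {B}" for B
    by blast
  then have "cohomology_class 0 X ` cocycles 0 X \<noteq> {B}" for B
    using bij_betw_imp_surj_on[OF bij] by (metis image_empty image_insert)
  moreover have "point_cochain X (\<lambda>x. 0) \<in> cocycles 0 X"
    by (rule point_cochain_cocycle) simp
  ultimately obtain A B where AB: "A \<in> cocycles 0 X" "B \<in> cocycles 0 X" "A \<noteq> B"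
    by blast
  show "topspace X \<noteq> {}"
  proof
    assume "topspace X = {}"
    then have "\<not> singular_simplex 0 X \<sigma>" for \<sigma>
      by (simp add: singular_simplex_0_iff)
    then have "A = B"
      using AB
      by (simp add: cocycles_def carrier_cochain_group fun_eq_iff)
    with AB(3) show False ..
  qed
  show "path_connected_space X"
    unfolding path_connected_space_def
  proof (intro ballI, rule ccontr)
    fix x y assume x: "x \<in> topspace X" and y: "y \<in> topspace X"
      and no: "\<not> (\<exists>\<gamma>. pathin X \<gamma> \<and> \<gamma> 0 = x \<and> \<gamma> 1 = y)"
    \<comment> \<open>The indicator of the path component of \<open>x\<close> would be a third
      cocycle besides the constants 0 and 1.\<close>
    define k where "k z = (of_bool (path_component_of X x z) :: bit)" for z
    have "k (\<gamma> 0) = k (\<gamma> 1)" if "pathin X \<gamma>" for \<gamma>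
    proof -
      have "path_component_of X (\<gamma> 0) (\<gamma> 1)"
        using that unfolding path_component_of_def by blast
      then have "path_component_of X x (\<gamma> 0) \<longleftrightarrow> path_component_of X x (\<gamma> 1)"
        by (metis path_component_of_sym path_component_of_trans)
      then show ?thesis by (simp add: k_def)
    qed
    then have "point_cochain X k \<in> cocycles 0 X"
      by (rule point_cochain_cocycle)
    moreover have "point_cochain X (\<lambda>x. 0) \<in> cocycles 0 X" "point_cochain X (\<lambda>x. 1) \<in> cocycles 0 X"
      by (rule point_cochain_cocycle; simp)+
    moreover have "k x = 1" "k y = 0"
      unfolding k_def using x no by (simp_all only: path_component_of_refl path_component_of_def of_bool_eq)
    then have "point_cochain X k \<noteq> point_cochain X (\<lambda>x. 0)" "point_cochain X k \<noteq> point_cochain X (\<lambda>x. 1)"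
      "point_cochain X (\<lambda>x. 0) \<noteq> point_cochain X (\<lambda>x. 1)"
      using ne[OF x, of k "\<lambda>x. 0"] ne[OF y, of k "\<lambda>x. 1"] ne[OF x, of "\<lambda>x. 0" "\<lambda>x. 1"] by simp_all
    ultimately show False
      using two[of "cohomology_class 0 X (point_cochain X k)"
          "cohomology_class 0 X (point_cochain X (\<lambda>x. 0))" "cohomology_class 0 X (point_cochain X (\<lambda>x. 1))"]
      by (simp add: cohomology_class_0_eq_iff)
  qed
qed

lemma mod2_cohomology_iso_coboundaries:
  assumes "X \<simeq>\<^sub>2 Y" "cocycles p Y \<subseteq> coboundaries p Y"
  shows "cocycles p X \<subseteq> coboundaries p X"
proof
  fix a assume a: "a \<in> cocycles p X"
  obtain h where "h \<in> iso (cohomology_group p X) (cohomology_group p Y)"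
    using assms unfolding mod2_cohomology_iso_def by blast
  then have bij: "bij_betw h (cohomology_class p X ` cocycles p X) (cohomology_class p Y ` cocycles p Y)"
    by (simp add: Group.iso_def carrier_cohomology_group)
  have "cohomology_class p Y b = cohomology_class p Y (\<lambda>\<sigma>. 0)" if "b \<in> cocycles p Y" for b
    using that assms(2) by (auto simp: cohomology_class_eq_iff)
  then have "B = cohomology_class p Y (\<lambda>\<sigma>. 0)" if "B \<in> cohomology_class p Y ` cocycles p Y" for B
    using that by blast
  then have "h (cohomology_class p X b) = cohomology_class p Y (\<lambda>\<sigma>. 0)" if "b \<in> cocycles p X" for b
    using bij_betwE[OF bij, rule_format, OF imageI[OF that]] by blast
  moreover have z: "(\<lambda>\<sigma>. 0) \<in> cocycles p X"
    using coboundaries_zero coboundaries_subset by blast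
  ultimately have "cohomology_class p X a = cohomology_class p X (\<lambda>\<sigma>. 0)"
    using a by (simp add: inj_onD[OF bij_betw_imp_inj_on[OF bij]])
  then show "a \<in> coboundaries p X"
    by (simp add: cohomology_class_eq_iff)
qed

section \<open>The winding cocycle of an odd map\<close>

text \<open>
  The number of turns by which a continuous logarithm along \<open>p\<close> differs from the principal one
  (an arbitrary integer if \<open>p\<close> is not continuous or has a zero).
\<close>

definition log_defect :: "(real \<Rightarrow> complex) \<Rightarrow> int" where
  "log_defect p = (SOME n. \<exists>L. continuous_on {0..1} L \<and> (\<forall>t\<in>{0..1}. p t = exp (L t)) \<and>
     L 1 - L 0 = Ln (p 1) - Ln (p 0) + of_int (2 * n) * pi * \<i>)"

lemma continuous_log_unique_change:
  fixes L L' :: "real \<Rightarrow> complex"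
  assumes "continuous_on {0..1} L" "continuous_on {0..1} L'"
    and "\<And>t. t \<in> {0..1} \<Longrightarrow> exp (L t) = exp (L' t)"
  shows "L 1 - L 0 = L' 1 - L' 0"
proof -
  have "(\<lambda>t. L t - L' t) constant_on {0..1}"
  proof (rule continuous_discrete_range_constant)
    show "continuous_on {0..1} (\<lambda>t. L t - L' t)"
      using assms by (intro continuous_intros)
    fix t :: real assume t: "t \<in> {0..1}"
    have "2 * pi \<le> norm ((L u - L' u) - (L t - L' t))"
      if u: "u \<in> {0..1}" and ne: "L u - L' u \<noteq> L t - L' t" for u
    proof -
      obtain m n :: int where mn: "L u = L' u + (of_int (2 * m) * pi) * \<i>"
        "L t = L' t + (of_int (2 * n) * pi) * \<i>"
        using assms(3)[OF u] assms(3)[OF t] unfolding exp_eq by blast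
      then have "m \<noteq> n" using ne by auto
      then have "2 * pi * 1 \<le> 2 * pi * \<bar>real_of_int (m - n)\<bar>"
        by (intro mult_left_mono; linarith?) simp
      moreover have "(L u - L' u) - (L t - L' t) = of_real (2 * pi * real_of_int (m - n)) * \<i>"
        using mn by (simp add: algebra_simps)
      ultimately show ?thesis
        by (simp only: norm_mult norm_of_real norm_ii abs_mult) simp
    qed
    then show "\<exists>e>0. \<forall>u. u \<in> {0..1} \<and> L u - L' u \<noteq> L t - L' t \<longrightarrow>
        e \<le> norm ((L u - L' u) - (L t - L' t))"
      by (intro exI[of _ "2 * pi"]) auto
  qed auto
  then have "L 1 - L' 1 = L 0 - L' 0"
    unfolding constant_on_def by force
  then show ?thesis
    by (simp add: algebra_simps)
qed

text \<open>The integer chosen in \<open>log_defect\<close> belongs to some logarithm; as all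
  continuous logarithms change by the same amount, it serves for every \<open>L\<close>.\<close>

lemma log_defect_eq:
  assumes L: "continuous_on {0..1} L" "\<And>t. t \<in> {0..1} \<Longrightarrow> p t = exp (L t)"
  shows "L 1 - L 0 = Ln (p 1) - Ln (p 0) + of_int (2 * log_defect p) * pi * \<i>"
proof -
  have p: "p 0 = exp (L 0)" "p 1 = exp (L 1)"
    using L(2) by auto
  then have "exp (L 1 - L 0) = exp (Ln (p 1) - Ln (p 0))"
    by (simp add: exp_diff)
  then obtain n where "L 1 - L 0 = Ln (p 1) - Ln (p 0) + of_int (2 * n) * pi * \<i>"
    unfolding exp_eq by blast
  then have "\<exists>n L. continuous_on {0..1} L \<and> (\<forall>t\<in>{0..1}. p t = exp (L t)) \<and>
     L 1 - L 0 = Ln (p 1) - Ln (p 0) + of_int (2 * n) * pi * \<i>"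
    using L by blast
  from someI_ex[OF this, folded log_defect_def]
  obtain L' where "continuous_on {0..1} L'" "\<forall>t\<in>{0..1}. p t = exp (L' t)"
    "L' 1 - L' 0 = Ln (p 1) - Ln (p 0) + of_int (2 * log_defect p) * pi * \<i>"
    by blast
  with continuous_log_unique_change[OF L(1), of L'] L(2) show ?thesis
    by (metis (no_types, lifting))
qed

section \<open>Additivity of the defect over a 2-simplex\<close>

definition triangle_point :: "complex \<Rightarrow> nat \<Rightarrow> real" where
  "triangle_point z = (\<lambda>i. if i = 0 then 1 - Re z - Im z else if i = 1 then Re z
     else if i = 2 then Im z else 0)"

text \<open>A copy of the standard 2-simplex with corners 0, 1 and \<i> for the vertices 0, 1 and 2.
  Being convex in a normed space, it admits continuous logarithms of nonvanishing maps.\<close>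

definition triangle :: "complex set" where
  "triangle = {z. 0 \<le> Re z \<and> 0 \<le> Im z \<and> Re z + Im z \<le> 1}"

lemma contractible_triangle: "contractible triangle"
proof (rule convex_imp_contractible)
  have "triangle = {z. Re z \<ge> 0} \<inter> ({z. Im z \<ge> 0} \<inter> {z. (1 + \<i>) \<bullet> z \<le> 1})"
    by (auto simp: triangle_def inner_complex_def)
  then show "convex triangle"
    by (metis convex_Int convex_halfspace_Re_ge convex_halfspace_Im_ge convex_halfspace_le)
qed

lemma continuous_map_triangle_simplex:
  assumes "singular_simplex 2 X \<tau>"
  shows "continuous_map (top_of_set triangle) X (\<lambda>z. \<tau> (triangle_point z))"
proof -
  have "continuous_on triangle (\<lambda>z. triangle_point z k)" for k
    unfolding triangle_point_def
    by (cases "k = 0"; cases "k = 1"; cases "k = 2") (auto intro!: continuous_intros)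
  then have "continuous_map (top_of_set triangle) (powertop_real UNIV) triangle_point"
    by (simp only: continuous_map_componentwise_UNIV continuous_map_iff_continuous simp_thms)
  moreover have "triangle_point z \<in> standard_simplex 2" if "z \<in> triangle" for z
    using that by (auto simp: standard_simplex_def triangle_point_def triangle_def numeral_2_eq_2)
  ultimately have "continuous_map (top_of_set triangle)
      (subtopology (powertop_real UNIV) (standard_simplex 2)) triangle_point"
    by (simp only: continuous_map_in_subtopology topspace_euclidean_subtopology Pi_iff) blast
  then have "continuous_map (top_of_set triangle) X (\<tau> \<circ> triangle_point)"
    using assms unfolding singular_simplex_def by (blast intro: continuous_map_compose)
  then show ?thesis
    by (simp add: o_def)
qed

lemma singular_face_2_edge_point:
  assumes "t \<in> {0..1}"
  shows "singular_face 2 0 \<tau> (edge_point t) = \<tau> (triangle_point (Complex (1 - t) t))"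
    "singular_face 2 1 \<tau> (edge_point t) = \<tau> (triangle_point (Complex 0 t))"
    "singular_face 2 2 \<tau> (edge_point t) = \<tau> (triangle_point (Complex t 0))"
proof -
  have "simplical_face 0 (edge_point t) = triangle_point (Complex (1 - t) t)"
    "simplical_face 1 (edge_point t) = triangle_point (Complex 0 t)"
    "simplical_face 2 (edge_point t) = triangle_point (Complex t 0)"
    by (auto simp: simplical_face_def edge_point_def triangle_point_def fun_eq_iff)
  moreover have "edge_point t \<in> standard_simplex (2 - Suc 0)"
    using edge_point_simplex[OF assms] by simp
  ultimately show "singular_face 2 0 \<tau> (edge_point t) = \<tau> (triangle_point (Complex (1 - t) t))"
    "singular_face 2 1 \<tau> (edge_point t) = \<tau> (triangle_point (Complex 0 t))"
    "singular_face 2 2 \<tau> (edge_point t) = \<tau> (triangle_point (Complex t 0))"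
    by (simp_all add: singular_face_def)
qed

text \<open>One logarithm on the whole triangle restricts to all three edges. Face 1 is the edge
  from vertex 0 to vertex 2, and the change along it is the sum of the changes along faces 2 and
  0.\<close>

lemma log_defect_triangle:
  assumes \<tau>: "singular_simplex 2 X \<tau>" and F: "continuous_map X euclidean F"
    and nz: "\<And>x. x \<in> topspace X \<Longrightarrow> F x \<noteq> 0"
  defines "d \<equiv> \<lambda>k. log_defect (\<lambda>t. F (singular_face 2 k \<tau> (edge_point t)))"
  shows "d 1 = d 0 + d 2"
proof -
  let ?G = "\<lambda>z. F (\<tau> (triangle_point z))"
  note c = continuous_map_triangle_simplex[OF \<tau>]
  have "continuous_map (top_of_set triangle) euclidean ?G"
    using continuous_map_compose[OF c F] by (simp add: o_def)
  then have "continuous_on triangle ?G"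
    by simp
  moreover have "?G z \<noteq> 0" if "z \<in> triangle" for z
    using c that by (intro nz) (auto simp: continuous_map_def)
  ultimately obtain l where l: "continuous_on triangle l" "\<And>z. z \<in> triangle \<Longrightarrow> ?G z = exp (l z)"
    using continuous_logarithm_on_contractible[OF _ contractible_triangle, of ?G] by blast
  have e: "l (q 1) - l (q 0) = Ln (?G (q 1)) - Ln (?G (q 0)) + of_int (2 * d k) * pi * \<i>"
    if "\<And>t. t \<in> {0..1} \<Longrightarrow> F (singular_face 2 k \<tau> (edge_point t)) = ?G (q t)"
      "continuous_on {0..1} q" "\<And>t. t \<in> {0..1} \<Longrightarrow> q t \<in> triangle" for q k
  proof -
    have "continuous_on {0..1} (\<lambda>t. l (q t))"
      using that by (intro continuous_on_compose2[OF l(1)]) auto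
    from log_defect_eq[OF this, of "\<lambda>t. F (singular_face 2 k \<tau> (edge_point t))"]
    show ?thesis
      using that l(2) by (simp add: d_def)
  qed
  have tri: "Complex a b \<in> triangle \<longleftrightarrow> 0 \<le> a \<and> 0 \<le> b \<and> a + b \<le> 1" for a b
    by (simp add: triangle_def)
  \<comment> \<open>The corner values of the continuous logarithm (\<open>a\<close>,
    \<open>b\<close>, \<open>c\<close>) and of the principal one (\<open>A\<close>,
    \<open>B\<close>, \<open>C\<close>) cancel separately, leaving only the defects.\<close>
  have add: "P1 = P0 + P2" if "a - b = A - B + P0" "a - c = A - C + P1" "b - c = B - C + P2"
    for a b c A B C P0 P1 P2 :: complex
  proof -
    have "P0 = (a - b) - (A - B)" "P1 = (a - c) - (A - C)" "P2 = (b - c) - (B - C)"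
      using that by simp_all
    then show ?thesis by simp
  qed
  have "l (Complex (1 - 1) 1) - l (Complex (1 - 0) 0) =
      Ln (?G (Complex (1 - 1) 1)) - Ln (?G (Complex (1 - 0) 0)) + of_int (2 * d 0) * pi * \<i>"
    by (rule e[of 0 "\<lambda>t. Complex (1 - t) t"])
      (auto simp: singular_face_2_edge_point tri simp del: One_nat_def intro!: continuous_intros)
  then have "l (Complex 0 1) - l (Complex 1 0) =
      Ln (?G (Complex 0 1)) - Ln (?G (Complex 1 0)) + of_int (2 * d 0) * pi * \<i>"
    by (simp only: diff_self diff_zero)
  moreover have "l (Complex 0 1) - l (Complex 0 0) =
      Ln (?G (Complex 0 1)) - Ln (?G (Complex 0 0)) + of_int (2 * d 1) * pi * \<i>"
    by (rule e[of 1 "\<lambda>t. Complex 0 t"])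
      (auto simp: singular_face_2_edge_point tri simp del: One_nat_def intro!: continuous_intros)
  moreover have "l (Complex 1 0) - l (Complex 0 0) =
      Ln (?G (Complex 1 0)) - Ln (?G (Complex 0 0)) + of_int (2 * d 2) * pi * \<i>"
    by (rule e[of 2 "\<lambda>t. Complex t 0"])
      (auto simp: singular_face_2_edge_point tri simp del: One_nat_def intro!: continuous_intros)
  ultimately have "of_int (2 * d 1) * pi * \<i> = of_int (2 * d 0) * pi * \<i> + of_int (2 * d 2) * pi * \<i>"
    by (rule add)
  then have "of_int (d 1) * (2 * pi * \<i>) = of_int (d 0 + d 2) * (2 * pi * \<i>)"
    by (simp add: algebra_simps)
  then have "complex_of_int (d 1) = of_int (d 0 + d 2)"
    by simp
  then show ?thesis
    by (simp only: of_int_eq_iff)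
qed

definition winding_cochain :: "'a topology \<Rightarrow> ('a \<Rightarrow> complex) \<Rightarrow> 'a cochain" where
  "winding_cochain X F =
     (\<lambda>\<sigma>. if singular_simplex 1 X \<sigma> then of_int (log_defect (\<lambda>t. F (\<sigma> (edge_point t)))) else 0)"

lemma winding_cochain_cocycle:
  assumes "continuous_map X euclidean F" "\<And>x. x \<in> topspace X \<Longrightarrow> F x \<noteq> 0"
  shows "winding_cochain X F \<in> cocycles 1 X"
proof -
  have "coboundary 1 X (winding_cochain X F) \<tau> = 0" for \<tau>
  proof (cases "singular_simplex 2 X \<tau>")
    case True
    have "singular_simplex 1 X (singular_face 2 k \<tau>)" if "k \<le> 2" for k
      using singular_simplex_singular_face[OF True, of k] that by simp
    then have w: "winding_cochain X F (singular_face 2 k \<tau>) =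
        of_int (log_defect (\<lambda>t. F (singular_face 2 k \<tau> (edge_point t))))" if "k \<le> 2" for k
      using that by (simp add: winding_cochain_def)
    have "coboundary 1 X (winding_cochain X F) \<tau> = (\<Sum>k\<le>2. winding_cochain X F (singular_face 2 k \<tau>))"
      using True by (simp add: coboundary_def numeral_2_eq_2)
    also have "\<dots> = winding_cochain X F (singular_face 2 0 \<tau>) + winding_cochain X F (singular_face 2 1 \<tau>)
        + winding_cochain X F (singular_face 2 2 \<tau>)"
      by (simp add: numeral_2_eq_2)
    also have "\<dots> = 0"
    proof -
      have "x + (x + y) + y = 0" for x y :: bit
        by (cases x; cases y) auto
      then show ?thesis
        using log_defect_triangle[OF True assms]
        by (simp only: w le_refl zero_le one_le_numeral of_int_add)
    qed
    finally show ?thesis .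
  qed (simp add: coboundary_def numeral_2_eq_2)
  then show ?thesis
    by (simp add: cocycles_def carrier_cochain_group winding_cochain_def fun_eq_iff)
qed

lemma path_simplex_edge_point: "t \<in> {0..1} \<Longrightarrow> path_simplex \<gamma> (edge_point t) = \<gamma> t"
  using edge_point_simplex by (simp add: path_simplex_def edge_point_def)

text \<open>
  Along a path from \<open>x\<close> to \<open>g x\<close> the logarithm of \<open>F\<close> changes by an odd multiple of \<open>\<pi> i\<close>. The
  path followed by its \<open>g\<close>-translate is a loop, and the logarithm changes by the same amount on
  both parts, so the winding cocycle is \<open>1\<close> on this loop and cannot be a coboundary.
\<close>

theorem odd_map_has_zero:
  fixes F :: "'a \<Rightarrow> complex"
  assumes X: "path_connected_space X" "topspace X \<noteq> {}" "cocycles 1 X \<subseteq> coboundaries 1 X"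
    and g: "continuous_map X X g" "\<And>x. x \<in> topspace X \<Longrightarrow> g (g x) = x"
    and F: "continuous_map X euclidean F" "\<And>x. x \<in> topspace X \<Longrightarrow> F (g x) = - F x"
  shows "\<exists>x\<in>topspace X. F x = 0"
proof (rule ccontr)
  assume "\<not> ?thesis"
  then have nz: "\<And>x. x \<in> topspace X \<Longrightarrow> F x \<noteq> 0" by blast
  obtain h where h: "potential_of X h (winding_cochain X F)"
    using coboundaries_1_potential X(3) winding_cochain_cocycle[OF F(1) nz] by blast
  obtain x where x: "x \<in> topspace X"
    using X(2) by blast
  then have gx: "g x \<in> topspace X"
    using g(1) by (auto simp: continuous_map_def)
  obtain \<gamma> where \<gamma>: "pathin X \<gamma>" "\<gamma> 0 = x" "\<gamma> 1 = g x"
    using X(1) x gx unfolding path_connected_space_def by metis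
  have in_X: "\<gamma> t \<in> topspace X" if "t \<in> {0..1}" for t
    using \<gamma>(1) that by (auto simp: pathin_def continuous_map_def)
  have g\<gamma>: "pathin X (g \<circ> \<gamma>)"
    using \<gamma>(1) g(1) by (rule pathin_compose)
  have "continuous_map (top_of_set {0..1}) euclidean (F \<circ> \<gamma>)"
    using \<gamma>(1) F(1) unfolding pathin_def by (rule continuous_map_compose)
  then have "continuous_on {0..1} (F \<circ> \<gamma>)"
    by simp
  then obtain L where L: "continuous_on {0..1} L" "\<And>t. t \<in> {0..1} \<Longrightarrow> (F \<circ> \<gamma>) t = exp (L t)"
    using continuous_logarithm_on_contractible[of "{0..1}" "F \<circ> \<gamma>"] in_X nz
    by (auto simp: convex_imp_contractible)
  define m n where "m = log_defect (\<lambda>t. F (path_simplex \<gamma> (edge_point t)))"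
    and "n = log_defect (\<lambda>t. F (path_simplex (g \<circ> \<gamma>) (edge_point t)))"
  have "L 1 - L 0 = Ln (F (g x)) - Ln (F x) + of_int (2 * m) * pi * \<i>"
    using log_defect_eq[OF L(1), of "\<lambda>t. F (path_simplex \<gamma> (edge_point t))"] L(2) \<gamma>
    by (simp add: path_simplex_edge_point m_def)
  moreover have "L 1 - L 0 = Ln (F x) - Ln (F (g x)) + of_int (2 * n) * pi * \<i>"
  proof -
    \<comment> \<open>On the translated path \<open>F\<close> is negated, so adding
      \<open>pi * \<i>\<close> to \<open>L\<close> gives a logarithm there with the same total
      change.\<close>
    have "F (path_simplex (g \<circ> \<gamma>) (edge_point t)) = exp (L t + pi * \<i>)" if "t \<in> {0..1}" for t
      using that L(2) F(2)[OF in_X[OF that]] by (simp add: path_simplex_edge_point exp_add)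
    moreover have "continuous_on {0..1} (\<lambda>t. L t + pi * \<i>)"
      using L(1) by (intro continuous_intros)
    ultimately show ?thesis
      using log_defect_eq[of "\<lambda>t. L t + pi * \<i>" "\<lambda>t. F (path_simplex (g \<circ> \<gamma>) (edge_point t))"] \<gamma> g(2)[OF x]
      by (simp add: path_simplex_edge_point n_def)
  qed
  \<comment> \<open>The translate runs from \<open>g x\<close> back to \<open>x\<close>, so the
    principal logarithms occur with opposite signs and cancel in the sum.\<close>
  moreover have "2 * A = P + Q" if "A = B - C + P" "A = C - B + Q" for A B C P Q :: complex
  proof -
    have "P = A - (B - C)" "Q = A - (C - B)"
      using that by simp_all
    then show ?thesis by simp
  qed
  ultimately have "2 * (L 1 - L 0) = of_int (2 * m) * pi * \<i> + of_int (2 * n) * pi * \<i>"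
    by blast
  also have "\<dots> = 2 * (of_int (m + n) * pi * \<i>)"
    by (simp add: algebra_simps)
  finally have "L 1 - L 0 = of_int (m + n) * pi * \<i>"
    by (simp only: mult_cancel_left) simp
  then have change: "L 1 = L 0 + of_int (m + n) * pi * \<i>"
    by (simp add: algebra_simps)
  have "exp (L 1) = - exp (L 0)"
    using L(2)[of 0] L(2)[of 1] \<gamma> F(2)[OF x] by simp
  \<comment> \<open>An even \<open>m + n\<close> would change the logarithm by a multiple of
    \<open>2 * pi * \<i>\<close>, although \<open>F\<close> passes to its negative, which differs
    from it as \<open>F\<close> has no zero.\<close>
  moreover have "exp (L 1) = exp (L 0)" if "even (m + n)"
  proof -
    obtain k where "m + n = 2 * k"
      using \<open>even (m + n)\<close> by (rule evenE)
    then show ?thesis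
      unfolding exp_eq change by (intro exI[of _ k]) (simp only:)
  qed
  ultimately have odd: "odd (m + n)"
    by auto
  \<comment> \<open>The path and its translate have the same two end points in opposite order, so a
    potential gives both edges the same value in \<open>bit\<close>, and the sum is 0.\<close>
  have "of_int m = h (g x) + h x"
    using h singular_simplex_path_simplex[OF \<gamma>(1)] unfolding potential_of_def winding_cochain_def
    by (metis m_def path_simplex_ends(1,2) \<gamma>(2,3))
  moreover have "of_int n = h x + h (g x)"
    using h singular_simplex_path_simplex[OF g\<gamma>] unfolding potential_of_def winding_cochain_def
    by (metis n_def path_simplex_ends(1,2) \<gamma>(2,3) o_apply g(2)[OF x])
  ultimately have "(of_int (m + n) :: bit) = 0"
    by (simp add: add.commute)
  with odd show False
    by (auto elim!: oddE)
qed

theorem proposition7p7: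
  fixes r s :: nat
    and X :: "'a topology"
    and \<phi> :: "int \<Rightarrow> 'a \<Rightarrow> 'a"
    and f :: "'a \<Rightarrow> real ^ 2"
  assumes "1 \<le> s" and "s \<le> r"
    and "compact_space X" and "Hausdorff_space X"
    and "X \<simeq>\<^sub>2 milnor_manifold r s"
    and "free_action (integer_mod_group 2) X \<phi>"
    and "continuous_map X euclidean f"
  shows "coincidence_set (integer_mod_group 2) X \<phi> f 2 \<noteq> {}"
proof -
  have car: "carrier (integer_mod_group 2) = {0, 1}"
    by (auto simp: carrier_integer_mod_group)
  have act: "group_action (integer_mod_group 2) (topspace X) \<phi>" and g: "continuous_map X X (\<phi> 1)"
    using assms(6) by (auto simp: free_action_def topological_action_def car)
  interpret group_action "integer_mod_group 2" "topspace X" \<phi>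
    by (rule act)
  have id: "\<phi> 0 x = x" if "x \<in> topspace X" for x
    using id_eq_one that by (metis one_integer_mod_group restrict_apply')
  have inv: "\<phi> 1 (\<phi> 1 x) = x" if "x \<in> topspace X" for x
    using composition_rule[OF that, of 1 1] id[OF that] by (simp add: car)
  \<comment> \<open>The plane is read as the complex numbers to make logarithms available; since
    \<phi> 1 is an involution, exchanging \<open>x\<close> with its translate negates the
    difference.\<close>
  define F where "F x = Complex (f x $ 1 - f (\<phi> 1 x) $ 1) (f x $ 2 - f (\<phi> 1 x) $ 2)" for x
  have fg: "continuous_map X euclidean (\<lambda>x. f (\<phi> 1 x))"
    using continuous_map_compose[OF g assms(7)] by (simp add: o_def)
  have F: "continuous_map X euclidean F"
    using assms(7) fg unfolding continuous_map_atin limitin_canonical_iff F_def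
    by (auto intro!: tendsto_intros)
  have "F (\<phi> 1 x) = - F x" if "x \<in> topspace X" for x
    by (simp add: F_def inv[OF that] complex_eq_iff)
  then obtain x where x: "x \<in> topspace X" "F x = 0"
    using odd_map_has_zero[OF _ _ _ g inv F]
      mod2_cohomology_iso_connected[OF assms(5)] mod2_cohomology_iso_coboundaries[OF assms(5)]
      milnor_manifold_cohomology[OF assms(1,2)] by blast
  then have "f (\<phi> 0 x) = f (\<phi> 1 x)"
    by (auto simp: F_def complex_eq_iff vec_eq_iff forall_2 id)
  then have "x \<in> coincidence_set (integer_mod_group 2) X \<phi> f 2"
    unfolding coincidence_set_def using x(1) by (auto simp: car intro!: exI[of _ "[0, 1]"])
  then show ?thesis by blast
qed

end
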